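(* Let $H^0=(h^0_j)_{j\in\mathbb{Z}}$, $h^0_j=(p^0_j,\alpha^0_j)$, be a periodic sequence of Hermite couples. Suppose that $d^0_j\neq 0$ and $\beta^0_{j,J}\in B^*$ for all $j\in\mathbb{Z}$, where $B^*:=\{x\in\mathbb{R}^2:\|x\|_2\le 3\pi/4\}$. Then the iterates $H^\ell:=S_1^\ell H^0$ define a sequence of polygons $(p^\ell_j)_{j\in\mathbb{Z}}$, $\ell\in\mathbb{N}_0$, which converges to a $G^1$-limit curve. Moreover, the angles $\alpha^\ell_j$ converge to the arguments of $d^\ell_j$: $$\lim_{\ell\to\infty}\max_{j\in\mathbb{Z}}\bigl|\alpha^\ell_j-\arg d^\ell_j\bigr|=0 .$$
   Context: Points in the plane are complex numbers. A Hermite couple is a pair $h=(p,\alpha)$ of a point $p\in\mathbb{C}$ and a tangent angle $\alpha$; angles are understood modulo $2\pi$, and differences such as $\alpha-\arg d$ are represented by their value in $(-\pi,\pi]$. A sequence $H=(h_j)_{j\in\mathbb{Z}}$ is periodic if there is $k\ge 2$ with $h_{j+k}=h_j$ for all $j\in\mathbb{Z}$. Lagrange polynomials on $[0,1]$: $\ell^2_0(t)=(t-1)(2t-1)$, $\ell^2_{1/2}(t)=4t(1-t)$, $\ell^2_1(t)=t(2t-1)$. For continuous $\beta:[0,1]\to\mathbb{R}$ and $t\in[0,1]$ let $I(\beta,t):=\int_0^t e^{i\beta(s)}ds$ and $I(\beta):=I(\beta,1)$. Let $$\tilde f(\beta_0,\beta_1):=(\beta_0+\beta_1)\left(\frac{\beta_0^2+\beta_1^2}{68}-\frac{\beta_0\beta_1}{46}-\frac14\right).$$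 Clothoid average (at parameter $1/2$): given Hermite couples $h_0=(p_0,\alpha_0)$, $h_1=(p_1,\alpha_1)$ with $d:=p_1-p_0\ne0$, let $\beta_j:=\alpha_j-\arg d$ for $j=0,1$, and $\beta:=\beta_0\ell^2_0+\tilde f(\beta_0,\beta_1)\ell^2_{1/2}+\beta_1\ell^2_1$. Put $p(t):=p_0+\frac{d}{I(\beta)}I(\beta,t)$, a curve with tangent angle $\alpha(t)=\arg d+\beta(t)-\arg I(\beta)$. Then $\frac12h_0\oplus\frac12h_1:=(p(1/2),\alpha(1/2))$. The subdivision operator $S_1$ (Lane-Riesenfeld-type algorithm of degree 1) maps $H=(h_j)_{j\in\mathbb{Z}}$ to $H'=(h'_j)_{j\in\mathbb{Z}}$ with $h'_{2j}=h_j$ and $h'_{2j+1}=\frac12h_j\oplus\frac12h_{j+1}$. Notation at level $\ell$: $H^\ell=(h^\ell_j)_{j\in\mathbb{Z}}$, $h^\ell_j=(p^\ell_j,\alpha^\ell_j)$, $d^\ell_j:=p^\ell_{j+1}-p^\ell_j$, and $\beta^\ell_{j,J}:=(\beta^\ell_{j,0},\beta^\ell_{j,1})$ with $\beta^\ell_{j,0}:=\alpha^\ell_j-\arg d^\ell_j$, $\beta^\ell_{j,1}:=\alpha^\ell_{j+1}-\arg d^\ell_j$. Convergence of polygons: the piecewise linear functions on $\mathbb{R}$ interpolating the values $p^\ell_j$ at the parameters $2^{-\ell}j$, $j\in\mathbb{Z}$, converge uniformly as $\ell\to\infty$ to a continuous curve $p:\mathbb{R}\to\mathbb{C}$. The limit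 curve is $G^1$ (tangent continuous, a geometric notion not referring to differentiability of the parametrization) if at every parameter $\tau$ the oriented unit secant directions $\frac{p(t)-p(\tau)}{|p(t)-p(\tau)|}$ for $t\downarrow\tau$ and $\frac{p(\tau)-p(t)}{|p(\tau)-p(t)|}$ for $t\uparrow\tau$ both converge, to the same unit vector $T(\tau)$, and $T$ depends continuously on $\tau$. *)

theory Defs
  imports "HOL-Analysis.Analysis" "HOL-Library.Real_Mod"
begin

section \<open>Hermite couples\<close>

text \<open>A Hermite couple is a point with a tangent angle.  The angle is stored as a real
  representative and only matters modulo \<open>2 * pi\<close>.\<close>

type_synonym hermite = "complex \<times> real"

definition hermite_eq :: "hermite \<Rightarrow> hermite \<Rightarrow> bool" where
  "hermite_eq h h' \<longleftrightarrow> fst h = fst h' \<and> [snd h = snd h'] (rmod (2 * pi))"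

definition periodic_couples :: "(int \<Rightarrow> hermite) \<Rightarrow> bool" where
  "periodic_couples H \<longleftrightarrow> (\<exists>k::nat. k \<ge> 2 \<and> (\<forall>j. hermite_eq (H (j + int k)) (H j)))"

text \<open>The value of an angle in \<open>{-pi<..pi}\<close> (\<^const>\<open>Arg\<close> is the principal argument).\<close>

definition principal_angle :: "real \<Rightarrow> real" where
  "principal_angle x = Arg (cis x)"

definition chord :: "hermite \<Rightarrow> hermite \<Rightarrow> complex" where
  "chord h0 h1 = fst h1 - fst h0"

definition chord_angles :: "hermite \<Rightarrow> hermite \<Rightarrow> real \<times> real" where
  "chord_angles h0 h1 =
     (principal_angle (snd h0 - Arg (chord h0 h1)), principal_angle (snd h1 - Arg (chord h0 h1)))"

section \<open>Clothoid averages\<close>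

definition lagr0 :: "real \<Rightarrow> real" where "lagr0 t = (t - 1) * (2 * t - 1)"
definition lagr_half :: "real \<Rightarrow> real" where "lagr_half t = 4 * t * (1 - t)"
definition lagr1 :: "real \<Rightarrow> real" where "lagr1 t = t * (2 * t - 1)"

definition angle_integral :: "(real \<Rightarrow> real) \<Rightarrow> real \<Rightarrow> complex" where
  "angle_integral \<beta> t = integral {0..t} (\<lambda>s. exp (\<i> * complex_of_real (\<beta> s)))"

definition f_tilde :: "real \<Rightarrow> real \<Rightarrow> real" where
  "f_tilde b0 b1 = (b0 + b1) * ((b0\<^sup>2 + b1\<^sup>2) / 68 - b0 * b1 / 46 - 1 / 4)"

definition angle_poly :: "real \<times> real \<Rightarrow> real \<Rightarrow> real" where
  "angle_poly b t =
     fst b * lagr0 t + f_tilde (fst b) (snd b) * lagr_half t + snd b * lagr1 t"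

definition clothoid_point :: "hermite \<Rightarrow> hermite \<Rightarrow> real \<Rightarrow> complex" where
  "clothoid_point h0 h1 t =
     (let \<beta> = angle_poly (chord_angles h0 h1)
      in fst h0 + chord h0 h1 / angle_integral \<beta> 1 * angle_integral \<beta> t)"

definition clothoid_angle :: "hermite \<Rightarrow> hermite \<Rightarrow> real \<Rightarrow> real" where
  "clothoid_angle h0 h1 t =
     (let \<beta> = angle_poly (chord_angles h0 h1)
      in Arg (chord h0 h1) + \<beta> t - Arg (angle_integral \<beta> 1))"

definition clothoid_average :: "hermite \<Rightarrow> hermite \<Rightarrow> hermite" where
  "clothoid_average h0 h1 = (clothoid_point h0 h1 (1 / 2), clothoid_angle h0 h1 (1 / 2))"

text \<open>In HOL \<^const>\<open>clothoid_average\<close> is total; it has its intended meaning exactly when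
  the points differ and the normalising denominator does not vanish.\<close>

definition clothoid_average_defined :: "hermite \<Rightarrow> hermite \<Rightarrow> bool" where
  "clothoid_average_defined h0 h1 \<longleftrightarrow>
     chord h0 h1 \<noteq> 0 \<and> angle_integral (angle_poly (chord_angles h0 h1)) 1 \<noteq> 0"

section \<open>Subdivision\<close>

definition S1 :: "(int \<Rightarrow> hermite) \<Rightarrow> int \<Rightarrow> hermite" where
  "S1 H n = (if even n then H (n div 2) else clothoid_average (H (n div 2)) (H (n div 2 + 1)))"

definition Bstar :: "(real \<times> real) set" where
  "Bstar = {x. norm x \<le> 3 * pi / 4}"

section \<open>Limit curves\<close>

text \<open>The piecewise linear function interpolating \<open>P j\<close> at the parameters \<open>j / 2 ^ l\<close>.\<close>

definition polygon :: "nat \<Rightarrow> (int \<Rightarrow> complex) \<Rightarrow> real \<Rightarrow> complex" where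
  "polygon l P t =
     (let j = \<lfloor>2 ^ l * t\<rfloor>; s = 2 ^ l * t - of_int j
      in (1 - s) *\<^sub>R P j + s *\<^sub>R P (j + 1))"

definition polygons_converge_to :: "(nat \<Rightarrow> int \<Rightarrow> complex) \<Rightarrow> (real \<Rightarrow> complex) \<Rightarrow> bool" where
  "polygons_converge_to P p \<longleftrightarrow>
     continuous_on UNIV p \<and> uniform_limit UNIV (\<lambda>l. polygon l (P l)) p sequentially"

text \<open>Note \<open>sgn z = z /\<^sub>R norm z\<close> and \<open>sgn 0 = 0\<close>; since the limits below are unit
  vectors, they force \<open>p t \<noteq> p \<tau>\<close> for all \<open>t \<noteq> \<tau>\<close> close to \<open>\<tau>\<close>.\<close>

definition G1_curve :: "(real \<Rightarrow> complex) \<Rightarrow> bool" where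
  "G1_curve p \<longleftrightarrow>
     (\<exists>T. continuous_on UNIV T \<and>
        (\<forall>\<tau>. norm (T \<tau>) = 1 \<and>
           ((\<lambda>t. sgn (p t - p \<tau>)) \<longlongrightarrow> T \<tau>) (at_right \<tau>) \<and>
           ((\<lambda>t. sgn (p \<tau> - p t)) \<longlongrightarrow> T \<tau>) (at_left \<tau>)))"

end

theory Submission
  imports Defs
begin

text \<open>One step of the scheme bisects every segment of the polygon.  Consider a single segment with chord
  angles \<open>b0\<close>, \<open>b1\<close> and put \<open>x = (b0 + b1) / 2\<close>, \<open>y = (b0 - b1) / 2\<close>.  The angle function \<open>\<beta>\<close> is a quadratic
  polynomial.  On the whole segment and on each half, after removing its mean and
  rescaling to \<open>{- 1..1}\<close>, it becomes \<open>c * s + d * legendre2 s\<close> up to the sign of \<open>c\<close>, where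
  \<open>d\<close> is \<open>x\<close> times a factor between 0 and 1.  The mean is the direction of the chord of the corresponding arc up to
  the argument of \<open>\<integral> cis (c * s + d * legendre2 s)\<close>.  Oddness of the linear part shows
  that this argument is \<open>- d * \<rho>\<close> with an explicitly bounded \<open>\<rho>\<close>
  (\<open>Arg_phase_integral\<close>), hence a multiple of \<open>x\<close>.  So the new chord angles of the left half are
  \<open>x * P + y / 2\<close> and \<open>- (x * Q + y / 2)\<close>, where \<open>P\<close> and \<open>Q\<close> depend on \<open>x\<close> and \<open>y\<close> but are never much
  larger than their linearised values \<open>1\<close> and \<open>1 / 2\<close>.  The linearised map shrinks the Euclidean norm
  by a factor below \<open>0.93\<close>, and on the disk \<^const>\<open>Bstar\<close> the bounds for \<open>\<rho>\<close> leave enough room for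
  the factor \<open>199 / 200\<close> (\<open>bisected_angles_contract\<close>).  In the same way the chord lengths shrink by the
  factor \<open>15 / 16\<close> (\<open>clothoid_average_refines\<close>).

  Consequently all chord angles tend to zero geometrically, which is the last claim.  The convergence
  to a \<open>G1\<close> curve follows from a general fact about interpolatory refinement of polygons
  (\<open>converges_to_G1_curve\<close>).  Geometric decay of the edge lengths gives a continuous limit curve.
  A chord angle measures the distance of an edge direction to the tangent at a common vertex, which
  persists under refinement.  Edge directions therefore form Cauchy sequences, uniformly in the
  parameter, and have a continuous limit \<open>T\<close>.  Near a parameter \<open>\<tau>\<close>, all edges of all fine levels lie in
  a narrow convex cone around \<open>T \<tau>\<close>, and so do their sums and the limits of those, that is, the secants
  of the limit curve.\<close>

section \<open>Limits along dyadic refinement\<close>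

text \<open>A parameter \<open>t\<close> lies at level \<open>l\<close> in the dyadic interval number \<open>\<lfloor>2 ^ l * t\<rfloor>\<close>, and interval \<open>n\<close> of
  level \<open>l + 1\<close> is contained in interval \<open>n div 2\<close> of level \<open>l\<close>.  All estimates below compare data
  attached to an interval with data attached to the coarser intervals containing it.\<close>
lemma floor_dyadic_coarsen: "\<lfloor>2 ^ (l + k) * t\<rfloor> div 2 ^ k = \<lfloor>2 ^ l * t :: real\<rfloor>"
proof -
  have "\<lfloor>2 ^ l * t\<rfloor> = \<lfloor>(2 ^ (l + k) * t) / real_of_int (2 ^ k)\<rfloor>"
    by (simp add: power_add)
  also have "\<dots> = \<lfloor>2 ^ (l + k) * t\<rfloor> div 2 ^ k"
    by (rule floor_divide_real_eq_div) simp
  finally show ?thesis ..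
qed

lemma floor_dyadic_near:
  fixes s t :: real
  assumes "\<bar>s - t\<bar> < 1 / 2 ^ l"
  shows "\<bar>\<lfloor>2 ^ l * s\<rfloor> - \<lfloor>2 ^ l * t\<rfloor>\<bar> \<le> 1"
proof -
  have "\<bar>2 ^ l * s - 2 ^ l * t\<bar> = 2 ^ l * \<bar>s - t\<bar>"
    by (simp add: abs_mult flip: right_diff_distrib)
  also have "\<dots> < 1" using assms by (simp add: field_simps)
  finally show ?thesis by linarith
qed

text \<open>Passing from interval \<open>n\<close> of level \<open>l + k\<close> to its ancestor of level \<open>l\<close> takes \<open>k\<close> steps, whose
  sizes are dominated by a geometric series; the bound does not depend on \<open>k\<close>.\<close>
lemma refinement_telescope:
  fixes f :: "nat \<Rightarrow> int \<Rightarrow> 'a::real_normed_vector"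
  assumes s: "0 \<le> s" "s < 1" and C: "0 \<le> C"
    and step: "\<And>l n. norm (f (Suc l) n - f l (n div 2)) \<le> C * s ^ l"
  shows "norm (f (l + k) n - f l (n div 2 ^ k)) \<le> C / (1 - s) * s ^ l"
proof -
  \<comment> \<open>The partial sum of the geometric series is kept, since the induction needs its exact value.\<close>
  have "norm (f (l + k) n - f l (n div 2 ^ k)) \<le> C / (1 - s) * s ^ l * (1 - s ^ k)" for k n
  proof (induction k arbitrary: n)
    case 0
    then show ?case by simp
  next
    case (Suc k)
    have "norm (f (l + Suc k) n - f l (n div 2 ^ Suc k))
        = norm ((f (Suc (l + k)) n - f (l + k) (n div 2)) + (f (l + k) (n div 2) - f l (n div 2 div 2 ^ k)))"
      by (simp add: zdiv_zmult2_eq)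
    also have "\<dots> \<le> C * s ^ (l + k) + C / (1 - s) * s ^ l * (1 - s ^ k)"
      by (intro norm_triangle_le add_mono step Suc)
    also have "\<dots> = C / (1 - s) * s ^ l * (1 - s ^ Suc k)"
      using s by (simp add: field_simps power_add)
    finally show ?case .
  qed
  also have "C / (1 - s) * s ^ l * (1 - s ^ k) \<le> C / (1 - s) * s ^ l * 1"
    using s C by (intro mult_left_mono) auto
  finally show ?thesis by simp
qed

text \<open>Values on dyadic intervals that change geometrically little from an interval to its halves have
  a limit at every parameter, with a rate uniform in the parameter.  If in addition neighbouring
  intervals carry close values, the limit is continuous: two parameters closer than \<open>1 / 2 ^ l\<close>
  lie in the same or in adjacent intervals of level \<open>l\<close>.  This lemma yields the limit curve (with
  \<open>f\<close> the vertices) as well as its tangent field (with \<open>f\<close> the edge directions).\<close>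
lemma refinement_limit:
  fixes f :: "nat \<Rightarrow> int \<Rightarrow> 'a::banach"
  assumes s: "0 \<le> s" "s < 1" and C: "0 \<le> C"
    and step: "\<And>l n. norm (f (Suc l) n - f l (n div 2)) \<le> C * s ^ l"
    and adj: "\<And>l n. norm (f l (n + 1) - f l n) \<le> C * s ^ l"
  obtains L where "\<And>l (t :: real). norm (f l \<lfloor>2 ^ l * t\<rfloor> - L t) \<le> C / (1 - s) * s ^ l"
    and "continuous_on UNIV L"
proof -
  define B where "B l = C / (1 - s) * s ^ l" for l
  have B0: "B \<longlonglongrightarrow> 0"
    unfolding B_def using LIMSEQ_realpow_zero[OF s] by (intro tendsto_mult_right_zero) auto
  have B_less: "\<forall>\<^sub>F l in sequentially. B l < e" if "e > 0" for e
    using order_tendstoD(2)[OF B0 that] .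
  have tel: "norm (f (l + k) \<lfloor>2 ^ (l + k) * t\<rfloor> - f l \<lfloor>2 ^ l * t\<rfloor>) \<le> B l" for l k and t :: real
    using refinement_telescope[where f = f, OF s C step, of l k "\<lfloor>2 ^ (l + k) * t\<rfloor>"]
    by (simp add: floor_dyadic_coarsen B_def)
  have "Cauchy (\<lambda>l. f l \<lfloor>2 ^ l * t\<rfloor>)" for t :: real
  proof (rule metric_CauchyI)
    fix e :: real assume "e > 0"
    then obtain N where N: "B N < e / 2"
      using B_less[of "e / 2"] by (auto simp: eventually_sequentially)
    have "dist (f m \<lfloor>2 ^ m * t\<rfloor>) (f N \<lfloor>2 ^ N * t\<rfloor>) < e / 2" if "m \<ge> N" for m
      using tel[of N "m - N" t] that N by (simp add: dist_norm)
    then show "\<exists>N. \<forall>m\<ge>N. \<forall>n\<ge>N. dist (f m \<lfloor>2 ^ m * t\<rfloor>) (f n \<lfloor>2 ^ n * t\<rfloor>) < e"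
      by (metis dist_triangle_half_l)
  qed
  then have "\<exists>L. (\<lambda>l. f l \<lfloor>2 ^ l * t\<rfloor>) \<longlonglongrightarrow> L" for t :: real
    using Cauchy_convergent convergent_def by blast
  then obtain L where L: "(\<lambda>l. f l \<lfloor>2 ^ l * t\<rfloor>) \<longlonglongrightarrow> L t" for t :: real
    by metis
  have dist_L: "norm (f l \<lfloor>2 ^ l * t\<rfloor> - L t) \<le> B l" for l and t :: real
  proof -
    have "(\<lambda>k. f (k + l) \<lfloor>2 ^ (k + l) * t\<rfloor>) \<longlonglongrightarrow> L t"
      using LIMSEQ_ignore_initial_segment[OF L] .
    then have "(\<lambda>k. norm (f (k + l) \<lfloor>2 ^ (k + l) * t\<rfloor> - f l \<lfloor>2 ^ l * t\<rfloor>))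
        \<longlonglongrightarrow> norm (L t - f l \<lfloor>2 ^ l * t\<rfloor>)"
      by (intro tendsto_intros)
    then have "norm (L t - f l \<lfloor>2 ^ l * t\<rfloor>) \<le> B l"
      by (rule LIMSEQ_le_const2) (use tel[of l _ t] in \<open>auto simp: add.commute\<close>)
    then show ?thesis by (simp add: norm_minus_commute)
  qed
  have CB: "C * s ^ l \<le> B l" for l
  proof -
    have "C * s ^ l = B l * (1 - s)" using s by (simp add: B_def)
    also have "\<dots> \<le> B l" using s C by (intro mult_left_le) (auto simp: B_def)
    finally show ?thesis .
  qed
  have "continuous_on UNIV L"
    unfolding continuous_on_iff
  proof (intro ballI allI impI)
    fix t e :: real assume "e > 0"
    then obtain l where l: "B l < e / 3"
      using B_less[of "e / 3"] by (auto simp: eventually_sequentially)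
    have "dist (L u) (L t) < e" if "dist u t < 1 / 2 ^ l" for u
    proof -
      have "\<bar>\<lfloor>2 ^ l * u\<rfloor> - \<lfloor>2 ^ l * t\<rfloor>\<bar> \<le> 1"
        using floor_dyadic_near[of u t l] that by (simp add: dist_real_def)
      then have "\<lfloor>2 ^ l * u\<rfloor> = \<lfloor>2 ^ l * t\<rfloor> \<or> \<lfloor>2 ^ l * u\<rfloor> = \<lfloor>2 ^ l * t\<rfloor> + 1 \<or> \<lfloor>2 ^ l * t\<rfloor> = \<lfloor>2 ^ l * u\<rfloor> + 1"
        by arith
      moreover have "0 \<le> B l" using s C by (auto simp: B_def)
      ultimately have "dist (f l \<lfloor>2 ^ l * u\<rfloor>) (f l \<lfloor>2 ^ l * t\<rfloor>) \<le> B l"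
        using order_trans[OF adj[of l "\<lfloor>2 ^ l * t\<rfloor>"] CB[of l]]
          order_trans[OF adj[of l "\<lfloor>2 ^ l * u\<rfloor>"] CB[of l]]
        by (elim disjE) (auto simp: dist_norm norm_minus_commute)
      moreover have "dist (f l \<lfloor>2 ^ l * u\<rfloor>) (L u) \<le> B l" "dist (f l \<lfloor>2 ^ l * t\<rfloor>) (L t) \<le> B l"
        using dist_L by (auto simp: dist_norm)
      ultimately have "dist (L u) (L t) \<le> B l + B l + B l"
        using dist_triangle[of "L u" "L t" "f l \<lfloor>2 ^ l * u\<rfloor>"]
          dist_triangle[of "f l \<lfloor>2 ^ l * u\<rfloor>" "L t" "f l \<lfloor>2 ^ l * t\<rfloor>"]
        by (simp add: dist_commute)
      with l show ?thesis by simp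
    qed
    then show "\<exists>d>0. \<forall>u\<in>UNIV. dist u t < d \<longrightarrow> dist (L u) (L t) < e"
      by (intro exI[of _ "1 / 2 ^ l"]) auto
  qed
  with dist_L that show ?thesis by (auto simp: B_def)
qed

section \<open>Polygon refinement with tangents\<close>

text \<open>Having a direction within distance \<open>e\<close> of \<open>w\<close> means lying in a cone given by an inner product.
  In this form the condition is visibly stable under sums and limits, which is how it passes from
  the edges of the polygons to the secants of the limit curve.\<close>
lemma norm_sgn_diff_le_iff:
  fixes z w :: complex
  assumes "z \<noteq> 0" "norm w = 1" "0 \<le> e"
  shows "norm (sgn z - w) \<le> e \<longleftrightarrow> (1 - e\<^sup>2 / 2) * norm z \<le> z \<bullet> w"
proof -
  have "norm (sgn z - w) \<le> e \<longleftrightarrow> (norm (sgn z - w))\<^sup>2 \<le> e\<^sup>2"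
    using assms by (auto intro: power_mono dest: power2_le_imp_le)
  also have "(norm (sgn z - w))\<^sup>2 = 2 - 2 * (sgn z \<bullet> w)"
    using assms dot_norm_neg[of "sgn z" w] by (simp add: norm_sgn)
  also have "sgn z \<bullet> w = (z \<bullet> w) / norm z"
    by (simp add: sgn_div_norm field_simps)
  also have "2 - 2 * ((z \<bullet> w) / norm z) \<le> e\<^sup>2 \<longleftrightarrow> (1 - e\<^sup>2 / 2) * norm z \<le> z \<bullet> w"
    using assms by (simp add: field_simps)
  finally show ?thesis .
qed


text \<open>Interpolatory binary refinement of polygons with vertices \<open>P l j\<close> carrying unit tangents \<open>V l j\<close>.
  Old vertices keep their position and tangent, edges shrink geometrically, and every edge direction
  approaches the tangents at both of its ends geometrically.  The lengths of
  neighbouring edges may differ by any factor, so the limit can be expected to be smooth as a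
  geometric object only, not in its parametrisation.\<close>
locale tangential_refinement =
  fixes P V :: "nat \<Rightarrow> int \<Rightarrow> complex" and c q D r :: real
  assumes P_even: "P (Suc l) (2 * j) = P l j"
    and V_even: "V (Suc l) (2 * j) = V l j"
    and q: "0 \<le> q" "q < 1" and r: "0 \<le> r" "r < 1"
    and edge_nz: "P l (j + 1) - P l j \<noteq> 0"
    and edge_le: "norm (P l (j + 1) - P l j) \<le> D * r ^ l"
    and start_tangent: "norm (sgn (P l (j + 1) - P l j) - V l j) \<le> c * q ^ l"
    and end_tangent: "norm (sgn (P l (j + 1) - P l j) - V l (j + 1)) \<le> c * q ^ l"
begin

abbreviation "edge l j \<equiv> P l (j + 1) - P l j"

lemma D_pos: "0 < D"
proof -
  have "0 < norm (edge 0 0)" using edge_nz[of 0 0] by simp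
  also have "\<dots> \<le> D" using edge_le[of 0 0] by simp
  finally show ?thesis .
qed

lemma c_nonneg: "0 \<le> c"
  using order_trans[OF norm_ge_zero start_tangent[of 0 0]] by simp

text \<open>Each half of an edge shares a vertex with that edge, and the tangent at this vertex is not changed
  by the refinement; it serves as the intermediate direction.\<close>
lemma edge_direction_step:
  "norm (sgn (edge (Suc l) n) - sgn (edge l (n div 2))) \<le> 2 * c * q ^ l"
proof -
  have dec: "c * q ^ Suc l \<le> c * q ^ l"
    using c_nonneg q by (intro mult_left_mono power_decreasing) auto
  \<comment> \<open>\<open>v\<close> is the tangent at the shared vertex.\<close>
  have "\<exists>v. norm (sgn (edge (Suc l) n) - v) \<le> c * q ^ Suc l \<and> norm (sgn (edge l (n div 2)) - v) \<le> c * q ^ l"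
  proof (cases "even n")
    case True
    then obtain j where "n = 2 * j" by auto
    then show ?thesis
      using start_tangent[of "Suc l" n] start_tangent[of l j] V_even[of l j] by auto
  next
    case False
    then obtain j where "n = 2 * j + 1" by (rule oddE)
    moreover have "V (Suc l) (2 * j + 1 + 1) = V l (j + 1)"
      using V_even[of l "j + 1"] by (simp add: algebra_simps)
    ultimately show ?thesis
      using end_tangent[of "Suc l" n] end_tangent[of l j] by auto
  qed
  then obtain v where "norm (sgn (edge (Suc l) n) - v) \<le> c * q ^ l" "norm (sgn (edge l (n div 2)) - v) \<le> c * q ^ l"
    using dec by (meson order_trans)
  then show ?thesis
    using norm_diff_triangle_le[of "sgn (edge (Suc l) n)" v "c * q ^ l" "sgn (edge l (n div 2))" "c * q ^ l"]
    by (simp add: norm_minus_commute)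
qed

lemma edge_direction_adjacent:
  "norm (sgn (edge l (n + 1)) - sgn (edge l n)) \<le> 2 * c * q ^ l"
  using norm_diff_triangle_le[OF start_tangent[of l "n + 1"], of "sgn (edge l n)" "c * q ^ l"]
    end_tangent[of l n]
  by (simp add: norm_minus_commute)

lemma point_step: "norm (P (Suc l) n - P l (n div 2)) \<le> D * r ^ l"
proof (cases "even n")
  case True
  then obtain j where "n = 2 * j" by auto
  then show ?thesis using P_even[of l j] D_pos r by simp
next
  case False
  then obtain j where "n = 2 * j + 1" by (rule oddE)
  then have "norm (P (Suc l) n - P l (n div 2)) \<le> D * r ^ Suc l"
    using edge_le[of "Suc l" "2 * j"] P_even[of l j] by simp
  also have "\<dots> \<le> D * r ^ l"
    using D_pos r by (intro mult_left_mono power_decreasing) auto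
  finally show ?thesis .
qed

lemma P_dyadic: "P (l + k) (2 ^ k * j) = P l j"
proof (induction k)
  case (Suc k)
  then show ?case using P_even[of "l + k" "2 ^ k * j"] by (simp add: mult.assoc)
qed simp

text \<open>Bounds how far edge directions, at all levels from \<open>l\<close> on and at parameters closer than
  \<open>1 / 2 ^ l\<close> to \<open>\<tau>\<close>, differ from the limit tangent at \<open>\<tau>\<close>: descend to level \<open>l\<close>, move to the adjacent
  interval, and ascend to the limit.\<close>
definition cone_tol :: "nat \<Rightarrow> real" where
  "cone_tol l = (4 * c / (1 - q) + 2 * c) * q ^ l"

lemma cone_tol_nonneg: "0 \<le> cone_tol l"
  using c_nonneg q by (simp add: cone_tol_def)

lemma cone_tol_tendsto: "cone_tol \<longlonglongrightarrow> 0"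
  unfolding cone_tol_def using LIMSEQ_realpow_zero[OF q] by (intro tendsto_mult_right_zero) auto

text \<open>A polygonal chain whose edges point nearly in direction \<open>w\<close> has its end-to-end vector in the same
  convex cone around \<open>w\<close>, and this vector cannot vanish because the inner products with \<open>w\<close> add up
  without cancellation.\<close>
lemma edge_sum_in_cone:
  assumes w: "norm w = 1" and e: "0 \<le> e" "e < 1" and i: "i1 \<le> i2"
    and close: "\<And>n. i1 \<le> n \<Longrightarrow> n < i2 \<Longrightarrow> norm (sgn (edge m n) - w) \<le> e"
  shows "(1 - e\<^sup>2 / 2) * norm (P m i2 - P m i1) \<le> (P m i2 - P m i1) \<bullet> w"
    and "i1 < i2 \<Longrightarrow> 0 < (P m i2 - P m i1) \<bullet> w"
proof -
  have "e\<^sup>2 \<le> 1" using e by (simp add: power_le_one)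
  then have k: "0 < 1 - e\<^sup>2 / 2" by simp
  have edge_in: "(1 - e\<^sup>2 / 2) * norm (edge m n) \<le> edge m n \<bullet> w" if "i1 \<le> n" "n < i2" for n
    using norm_sgn_diff_le_iff[OF edge_nz w e(1)] close[OF that] by blast
  have cone: "(1 - e\<^sup>2 / 2) * norm (P m n - P m i1) \<le> (P m n - P m i1) \<bullet> w" if "i1 \<le> n" "n \<le> i2" for n
    using that
  proof (induction n rule: int_ge_induct)
    case (step n)
    have "(1 - e\<^sup>2 / 2) * norm (P m (n + 1) - P m i1)
        \<le> (1 - e\<^sup>2 / 2) * (norm (P m n - P m i1) + norm (edge m n))"
      using k norm_triangle_ineq[of "P m n - P m i1" "edge m n"] by (intro mult_left_mono) auto
    also have "\<dots> \<le> (P m n - P m i1) \<bullet> w + edge m n \<bullet> w"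
      using step edge_in[of n] by (simp add: distrib_left)
    finally show ?case by (simp add: algebra_simps inner_diff_left)
  qed simp
  then show "(1 - e\<^sup>2 / 2) * norm (P m i2 - P m i1) \<le> (P m i2 - P m i1) \<bullet> w" using i by blast
  assume less: "i1 < i2"
  have "0 < (1 - e\<^sup>2 / 2) * norm (edge m (i2 - 1))" using k edge_nz[of m "i2 - 1"] by simp
  also have "\<dots> \<le> edge m (i2 - 1) \<bullet> w" using less by (intro edge_in) auto
  finally have "0 < (P m i2 - P m (i2 - 1)) \<bullet> w" by simp
  moreover have "0 \<le> (P m (i2 - 1) - P m i1) \<bullet> w"
    using order_trans[OF _ cone[of "i2 - 1"], of 0] k less by simp
  ultimately show "0 < (P m i2 - P m i1) \<bullet> w" by (simp add: inner_diff_left)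
qed

text \<open>Close to \<open>\<tau>\<close> every secant of the limit curve is a limit of end-to-end vectors of chains whose edges
  lie in a narrow cone around the limit tangent \<open>T \<tau>\<close>, hence it lies in this cone itself.  The limit
  of nonzero vectors might vanish; this is excluded by the chain between two vertices of a fixed
  level, which are interpolated by the limit curve.\<close>
theorem converges_to_G1_curve: "\<exists>p. polygons_converge_to P p \<and> G1_curve p"
proof -
  obtain p where p: "\<And>l (t :: real). norm (P l \<lfloor>2 ^ l * t\<rfloor> - p t) \<le> D / (1 - r) * r ^ l"
    and p_cont: "continuous_on UNIV p"
    using refinement_limit[where f = P, OF r less_imp_le[OF D_pos] point_step edge_le] by blast
  obtain T where T: "\<And>l (t :: real). norm (sgn (edge l \<lfloor>2 ^ l * t\<rfloor>) - T t) \<le> 2 * c / (1 - q) * q ^ l"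
    and T_cont: "continuous_on UNIV T"
    using refinement_limit[where f = "\<lambda>l n. sgn (edge l n)" and C = "2 * c",
        OF q _ edge_direction_step edge_direction_adjacent] c_nonneg by auto
  have p_lim: "(\<lambda>l. P l \<lfloor>2 ^ l * t\<rfloor>) \<longlonglongrightarrow> p t" for t :: real
  proof (rule LIM_zero_cancel)
    have "(\<lambda>l. D / (1 - r) * r ^ l) \<longlonglongrightarrow> 0"
      using LIMSEQ_realpow_zero[OF r] by (intro tendsto_mult_right_zero) auto
    then show "(\<lambda>l. P l \<lfloor>2 ^ l * t\<rfloor> - p t) \<longlonglongrightarrow> 0"
      by (rule Lim_null_comparison[rotated]) (use p in auto)
  qed
  have T_norm: "norm (T t) = 1" for t
  proof -
    have "(\<lambda>l. 2 * c / (1 - q) * q ^ l) \<longlonglongrightarrow> 0"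
      using LIMSEQ_realpow_zero[OF q] by (intro tendsto_mult_right_zero) auto
    then have "(\<lambda>l. sgn (edge l \<lfloor>2 ^ l * t\<rfloor>) - T t) \<longlonglongrightarrow> 0"
      by (rule Lim_null_comparison[rotated]) (use T in auto)
    then have "(\<lambda>l. norm (sgn (edge l \<lfloor>2 ^ l * t\<rfloor>))) \<longlonglongrightarrow> norm (T t)"
      by (rule tendsto_norm[OF LIM_zero_cancel])
    moreover have "norm (sgn (edge l n)) = 1" for l n using edge_nz[of l n] by (simp add: norm_sgn)
    ultimately show ?thesis by (simp add: LIMSEQ_const_iff)
  qed
  have vertex: "p (of_int j / 2 ^ l) = P l j" for l j
  proof -
    have eq: "P (k + l) \<lfloor>2 ^ (k + l) * (real_of_int j / 2 ^ l)\<rfloor> = P l j" for k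
    proof -
      have "(2::real) ^ (k + l) * (of_int j / 2 ^ l) = of_int (2 ^ k * j)"
        by (simp add: power_add)
      then have "\<lfloor>2 ^ (k + l) * (real_of_int j / 2 ^ l)\<rfloor> = 2 ^ k * j" by (metis floor_of_int)
      then show ?thesis using P_dyadic[of l k j] by (simp add: add.commute)
    qed
    have "(\<lambda>k. P (k + l) \<lfloor>2 ^ (k + l) * (real_of_int j / 2 ^ l)\<rfloor>) \<longlonglongrightarrow> p (of_int j / 2 ^ l)"
      by (rule LIMSEQ_ignore_initial_segment[OF p_lim])
    then show ?thesis
      unfolding eq by (simp only: LIMSEQ_const_iff)
  qed
  have "uniform_limit UNIV (\<lambda>l. polygon l (P l)) p sequentially"
  proof (rule uniform_limitI)
    fix e :: real assume "e > 0"
    have "(\<lambda>l. (D + D / (1 - r)) * r ^ l) \<longlonglongrightarrow> 0"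
      using LIMSEQ_realpow_zero[OF r] by (intro tendsto_mult_right_zero) auto
    then have "\<forall>\<^sub>F l in sequentially. (D + D / (1 - r)) * r ^ l < e"
      using \<open>e > 0\<close> by (rule order_tendstoD)
    then show "\<forall>\<^sub>F l in sequentially. \<forall>t\<in>UNIV. dist (polygon l (P l) t) (p t) < e"
    proof (rule eventually_mono, intro ballI)
      fix l and t :: real assume l: "(D + D / (1 - r)) * r ^ l < e"
      define j where "j = \<lfloor>2 ^ l * t\<rfloor>"
      define s where "s = 2 ^ l * t - of_int j"
      have s: "0 \<le> s" "s \<le> 1" unfolding s_def j_def by linarith+
      have "polygon l (P l) t - P l j = s *\<^sub>R edge l j"
        by (simp add: polygon_def s_def j_def Let_def algebra_simps)
      then have "norm (polygon l (P l) t - P l j) = s * norm (edge l j)" using s by simp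
      also have "\<dots> \<le> D * r ^ l"
        using s by (intro order_trans[OF mult_left_le_one_le edge_le]) auto
      finally have "norm (polygon l (P l) t - p t) \<le> D * r ^ l + D / (1 - r) * r ^ l"
        using p[of l t] norm_diff_triangle_le[of "polygon l (P l) t" "P l j" _ "p t"] by (simp add: j_def)
      with l show "dist (polygon l (P l) t) (p t) < e" by (simp add: dist_norm algebra_simps)
    qed
  qed
  with p_cont have conv: "polygons_converge_to P p" by (simp add: polygons_converge_to_def)
  have near: "norm (sgn (edge (l + k) n) - T \<tau>) \<le> cone_tol l"
    if "\<bar>s1 - \<tau>\<bar> < 1 / 2 ^ l" "\<bar>s2 - \<tau>\<bar> < 1 / 2 ^ l"
      "\<lfloor>2 ^ (l + k) * s1\<rfloor> \<le> n" "n \<le> \<lfloor>2 ^ (l + k) * s2\<rfloor>" for s1 s2 \<tau> l k n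
  proof -
    define j where "j = \<lfloor>2 ^ l * \<tau>\<rfloor>"
    have "\<lfloor>2 ^ l * s1\<rfloor> \<le> n div 2 ^ k" "n div 2 ^ k \<le> \<lfloor>2 ^ l * s2\<rfloor>"
      using zdiv_mono1[OF that(3), of "2 ^ k"] zdiv_mono1[OF that(4), of "2 ^ k"]
      by (simp_all add: floor_dyadic_coarsen)
    then have "\<bar>n div 2 ^ k - j\<bar> \<le> 1"
      using floor_dyadic_near[OF that(1)] floor_dyadic_near[OF that(2)] unfolding j_def by linarith
    then have "n div 2 ^ k = j \<or> n div 2 ^ k = j + 1 \<or> j = n div 2 ^ k + 1" by arith
    moreover have "0 \<le> 2 * c * q ^ l" using c_nonneg q by simp
    ultimately have "norm (sgn (edge l (n div 2 ^ k)) - sgn (edge l j)) \<le> 2 * c * q ^ l"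
      using edge_direction_adjacent[of l j] edge_direction_adjacent[of l "n div 2 ^ k"]
      by (elim disjE) (auto simp: norm_minus_commute)
    moreover have "norm (sgn (edge (l + k) n) - sgn (edge l (n div 2 ^ k))) \<le> 2 * c / (1 - q) * q ^ l"
      using refinement_telescope[where f = "\<lambda>l n. sgn (edge l n)" and C = "2 * c", OF q _ edge_direction_step] c_nonneg
      by simp
    moreover have "norm (sgn (edge l j) - T \<tau>) \<le> 2 * c / (1 - q) * q ^ l"
      unfolding j_def by (rule T)
    ultimately have "norm (sgn (edge (l + k) n) - T \<tau>)
        \<le> 2 * c / (1 - q) * q ^ l + 2 * c * q ^ l + 2 * c / (1 - q) * q ^ l"
      by (meson norm_diff_triangle_le)
    then show ?thesis by (simp add: cone_tol_def algebra_simps)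
  qed
  \<comment> \<open>Both one-sided secant limits are instances of this estimate, with \<open>\<tau> = s1\<close> and \<open>\<tau> = s2\<close>.\<close>
  have secant: "p s2 - p s1 \<noteq> 0 \<and> norm (sgn (p s2 - p s1) - T \<tau>) \<le> cone_tol l"
    if s: "\<bar>s1 - \<tau>\<bar> < 1 / 2 ^ l" "\<bar>s2 - \<tau>\<bar> < 1 / 2 ^ l" "s1 < s2" and tol: "cone_tol l < 1"
    for s1 s2 \<tau> l
  proof -
    define k where "k = 1 - (cone_tol l)\<^sup>2 / 2"
    have "(cone_tol l)\<^sup>2 \<le> 1" using tol cone_tol_nonneg[of l] by (simp add: power_le_one)
    then have k: "0 \<le> k" by (simp add: k_def)
    have cone: "k * norm (p t2 - p t1) \<le> (p t2 - p t1) \<bullet> T \<tau>"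
      if t: "s1 \<le> t1" "t1 \<le> t2" "t2 \<le> s2" for t1 t2
    proof (rule LIMSEQ_le)
      show "(\<lambda>m. k * norm (P (m + l) \<lfloor>2 ^ (m + l) * t2\<rfloor> - P (m + l) \<lfloor>2 ^ (m + l) * t1\<rfloor>))
          \<longlonglongrightarrow> k * norm (p t2 - p t1)"
        by (intro tendsto_intros LIMSEQ_ignore_initial_segment[OF p_lim])
      show "(\<lambda>m. (P (m + l) \<lfloor>2 ^ (m + l) * t2\<rfloor> - P (m + l) \<lfloor>2 ^ (m + l) * t1\<rfloor>) \<bullet> T \<tau>)
          \<longlonglongrightarrow> (p t2 - p t1) \<bullet> T \<tau>"
        by (intro tendsto_intros LIMSEQ_ignore_initial_segment[OF p_lim])
      have "k * norm (P (m + l) \<lfloor>2 ^ (m + l) * t2\<rfloor> - P (m + l) \<lfloor>2 ^ (m + l) * t1\<rfloor>)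
          \<le> (P (m + l) \<lfloor>2 ^ (m + l) * t2\<rfloor> - P (m + l) \<lfloor>2 ^ (m + l) * t1\<rfloor>) \<bullet> T \<tau>" for m
        unfolding k_def
      proof (rule edge_sum_in_cone(1)[OF T_norm cone_tol_nonneg tol])
        show "\<lfloor>2 ^ (m + l) * t1\<rfloor> \<le> \<lfloor>2 ^ (m + l) * t2\<rfloor>" using t by (intro floor_mono) auto
        show "norm (sgn (edge (m + l) n) - T \<tau>) \<le> cone_tol l"
          if "\<lfloor>2 ^ (m + l) * t1\<rfloor> \<le> n" "n < \<lfloor>2 ^ (m + l) * t2\<rfloor>" for n
          using near[of t1 \<tau> l t2 m n] s t that by (simp add: add.commute)
      qed
      then show "\<exists>N. \<forall>m\<ge>N. k * norm (P (m + l) \<lfloor>2 ^ (m + l) * t2\<rfloor> - P (m + l) \<lfloor>2 ^ (m + l) * t1\<rfloor>)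
          \<le> (P (m + l) \<lfloor>2 ^ (m + l) * t2\<rfloor> - P (m + l) \<lfloor>2 ^ (m + l) * t1\<rfloor>) \<bullet> T \<tau>" by blast
    qed
    have mono: "0 \<le> (p t2 - p t1) \<bullet> T \<tau>" if "s1 \<le> t1" "t1 \<le> t2" "t2 \<le> s2" for t1 t2
      using order_trans[OF _ cone[OF that], of 0] k by simp
    \<comment> \<open>Two vertices of level \<open>l + m\<close> strictly between \<open>s1\<close> and \<open>s2\<close> exist as soon as this parameter interval is longer than two of its steps.\<close>
    obtain m where m: "2 / (s2 - s1) < 2 ^ m" using real_arch_pow[of 2] by auto
    have "(2::real) ^ m \<le> 2 ^ (l + m)" by (intro power_increasing) auto
    with m have "2 / (s2 - s1) < 2 ^ (l + m)" by linarith
    then have gap: "2 < 2 ^ (l + m) * s2 - 2 ^ (l + m) * s1" using s by (simp add: field_simps)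
    define i1 i2 where "i1 = \<lfloor>2 ^ (l + m) * s1\<rfloor> + 1" and "i2 = \<lfloor>2 ^ (l + m) * s2\<rfloor>"
    have i: "i1 < i2" using gap unfolding i1_def i2_def by linarith
    have "2 ^ (l + m) * s1 \<le> of_int i1" "of_int i2 \<le> 2 ^ (l + m) * s2"
      unfolding i1_def i2_def by linarith+
    then have x: "s1 \<le> of_int i1 / 2 ^ (l + m)" "of_int i2 / 2 ^ (l + m) \<le> s2"
      by (simp_all add: pos_le_divide_eq pos_divide_le_eq mult.commute)
    have x12: "of_int i1 / 2 ^ (l + m) \<le> (of_int i2 / 2 ^ (l + m) :: real)"
      using i by (intro divide_right_mono) auto
    have "0 < (P (l + m) i2 - P (l + m) i1) \<bullet> T \<tau>"
    proof (rule edge_sum_in_cone(2)[OF T_norm cone_tol_nonneg tol])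
      show "norm (sgn (edge (l + m) n) - T \<tau>) \<le> cone_tol l" if "i1 \<le> n" "n < i2" for n
        using near[OF s(1,2), of m n] that by (simp add: i1_def i2_def)
    qed (use i in auto)
    then have "0 < (p (of_int i2 / 2 ^ (l + m)) - p (of_int i1 / 2 ^ (l + m))) \<bullet> T \<tau>"
      by (simp add: vertex)
    moreover have "0 \<le> (p (of_int i1 / 2 ^ (l + m)) - p s1) \<bullet> T \<tau>"
      "0 \<le> (p s2 - p (of_int i2 / 2 ^ (l + m))) \<bullet> T \<tau>"
      using x x12 s by (auto intro!: mono)
    ultimately have "0 < (p s2 - p s1) \<bullet> T \<tau>" by (simp add: inner_diff_left)
    then have nz: "p s2 - p s1 \<noteq> 0" by auto
    then show ?thesis
      using norm_sgn_diff_le_iff[OF nz T_norm cone_tol_nonneg] cone[of s1 s2] s by (simp add: k_def)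
  qed
  have small: "\<exists>l. cone_tol l < e \<and> cone_tol l < 1" if "e > 0" for e
  proof -
    have "\<forall>\<^sub>F l in sequentially. cone_tol l < min e 1"
      using order_tendstoD(2)[OF cone_tol_tendsto, of "min e 1"] that by simp
    then show ?thesis by (auto simp: eventually_sequentially)
  qed
  have "((\<lambda>t. sgn (p t - p \<tau>)) \<longlongrightarrow> T \<tau>) (at_right \<tau>)" for \<tau>
  proof (rule tendstoI)
    fix e :: real assume "e > 0"
    then obtain l where l: "cone_tol l < e" "cone_tol l < 1" using small by blast
    have "\<forall>\<^sub>F t in at_right \<tau>. t \<in> {\<tau><..<\<tau> + 1 / 2 ^ l}"
      by (rule eventually_at_right_real) simp
    then show "\<forall>\<^sub>F t in at_right \<tau>. dist (sgn (p t - p \<tau>)) (T \<tau>) < e"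
    proof (rule eventually_mono)
      fix t assume "t \<in> {\<tau><..<\<tau> + 1 / 2 ^ l}"
      then show "dist (sgn (p t - p \<tau>)) (T \<tau>) < e"
        using secant[of \<tau> \<tau> l t] l by (auto simp: dist_norm)
    qed
  qed
  moreover have "((\<lambda>t. sgn (p \<tau> - p t)) \<longlongrightarrow> T \<tau>) (at_left \<tau>)" for \<tau>
  proof (rule tendstoI)
    fix e :: real assume "e > 0"
    then obtain l where l: "cone_tol l < e" "cone_tol l < 1" using small by blast
    have "\<forall>\<^sub>F t in at_left \<tau>. t \<in> {\<tau> - 1 / 2 ^ l<..<\<tau>}"
      by (rule eventually_at_left_real) simp
    then show "\<forall>\<^sub>F t in at_left \<tau>. dist (sgn (p \<tau> - p t)) (T \<tau>) < e"
    proof (rule eventually_mono)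
      fix t assume "t \<in> {\<tau> - 1 / 2 ^ l<..<\<tau>}"
      then show "dist (sgn (p \<tau> - p t)) (T \<tau>) < e"
        using secant[of t \<tau> l \<tau>] l by (auto simp: dist_norm)
    qed
  qed
  ultimately have "G1_curve p" unfolding G1_curve_def using T_cont T_norm by blast
  with conv show ?thesis by blast
qed

end

section \<open>Integrals of quadratic phases\<close>

text \<open>The second Legendre polynomial.  It has mean zero on \<open>{- 1..1}\<close>, so \<open>c * s + d * legendre2 s\<close> is the
  general quadratic phase whose mean has been removed.\<close>
definition legendre2 :: "real \<Rightarrow> real" where
  "legendre2 s = (3 * s\<^sup>2 - 1) / 2"

definition phase_integral :: "real \<Rightarrow> real \<Rightarrow> complex" where
  "phase_integral c d = integral {-1..1} (\<lambda>s. cis (c * s + d * legendre2 s))"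

lemma cos_ge_quadratic: "1 - x\<^sup>2 / 2 \<le> cos (x :: real)"
proof -
  have "(sin (x / 2))\<^sup>2 \<le> (x / 2)\<^sup>2"
    using abs_sin_x_le_abs_x[of "x / 2"] by (metis abs_le_square_iff)
  then show ?thesis
    using cos_double_sin[of "x / 2"] by (simp add: power2_eq_square)
qed

lemma sin_ge_cubic:
  fixes x :: real
  assumes "0 \<le> x"
  shows "x - x ^ 3 / 6 \<le> sin x"
proof -
  have "\<bar>sin x - x\<bar> \<le> x ^ 3 / 6"
    using Maclaurin_sin_bound[of x 3] assms
    by (simp add: eval_nat_numeral sin_coeff_def)
  then show ?thesis by linarith
qed

lemma cos_mult_cos_ge: "1 - (x\<^sup>2 + y\<^sup>2) / 2 \<le> cos x * cos (y :: real)"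
proof -
  define p where "p = 2 * x * y"
  have "1 - (x\<^sup>2 + y\<^sup>2 - p) / 2 \<le> cos (x - y)" "1 - (x\<^sup>2 + y\<^sup>2 + p) / 2 \<le> cos (x + y)"
    using cos_ge_quadratic[of "x - y"] cos_ge_quadratic[of "x + y"]
    by (simp_all add: p_def power2_diff power2_sum)
  then have "2 - (x\<^sup>2 + y\<^sup>2) \<le> cos (x - y) + cos (x + y)"
    by (simp add: field_simps)
  then show ?thesis by (simp add: cos_times_cos field_simps)
qed

lemma has_integral_antiderivative:
  fixes F f :: "real \<Rightarrow> real"
  assumes "\<And>s. (F has_real_derivative f s) (at s)"
  shows "(f has_integral F 1 - F (- 1)) {- 1..1}"
  by (rule fundamental_theorem_of_calculus)
    (auto intro!: has_field_derivative_at_within assms simp flip: has_real_derivative_iff_has_vector_derivative)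


lemma integral_odd_eq_0:
  fixes f :: "real \<Rightarrow> real"
  assumes "\<And>s. f (- s) = - f s"
  shows "integral {- 1..1} f = 0"
proof -
  have "integral {- 1..1} f = integral {- 1..1} (\<lambda>s. f (- s))"
    using Henstock_Kurzweil_Integration.integral_reflect_real[of "1::real" "-1" f] by simp
  also have "\<dots> = - integral {- 1..1} f" by (simp add: assms)
  finally show ?thesis by simp
qed

lemma legendre2_minus [simp]: "legendre2 (- s) = legendre2 s"
  by (simp add: legendre2_def)

lemma continuous_on_legendre2 [continuous_intros]:
  "continuous_on S f \<Longrightarrow> continuous_on S (\<lambda>s. legendre2 (f s))"
  unfolding legendre2_def by (intro continuous_intros) auto

lemma phase_integrable: "(\<lambda>s. cis (c * s + d * legendre2 s)) integrable_on {- 1..1}"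
  by (rule integrable_continuous_interval) (auto intro!: continuous_intros)

text \<open>The linear part of the phase is odd and its Legendre part is even, so after expanding \<open>cos\<close> and
  \<open>sin\<close> of the sum the terms with \<open>sin (c * s)\<close> integrate to zero.  As a consequence the imaginary part
  carries a factor \<open>sin (d * legendre2 s)\<close> and is of order \<open>d\<close> no matter how large \<open>c\<close> is.\<close>
lemma
  shows Re_phase_integral:
      "Re (phase_integral c d) = integral {- 1..1} (\<lambda>s. cos (c * s) * cos (d * legendre2 s))"
    and Im_phase_integral:
      "Im (phase_integral c d) = integral {- 1..1} (\<lambda>s. cos (c * s) * sin (d * legendre2 s))"
proof -
  have int: "(\<lambda>s. f (c * s) * g (d * legendre2 s)) integrable_on {- 1..1}"
    if "f \<in> {sin, cos}" "g \<in> {sin, cos}" for f g :: "real \<Rightarrow> real"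
    using that by (intro integrable_continuous_interval) (auto intro!: continuous_intros)
  have odd: "integral {- 1..1} (\<lambda>s. sin (c * s) * g (d * legendre2 s)) = 0" for g :: "real \<Rightarrow> real"
    by (rule integral_odd_eq_0) simp
  have "Re (phase_integral c d) = integral {- 1..1} (\<lambda>s. cos (c * s + d * legendre2 s))"
    unfolding phase_integral_def
    using integral_linear[OF phase_integrable bounded_linear_Re, of c d] by (simp add: o_def)
  also have "\<dots> = integral {- 1..1} (\<lambda>s. cos (c * s) * cos (d * legendre2 s))"
    using odd[of sin] int[of cos cos] int[of sin sin] by (simp add: cos_add integral_diff)
  finally show "Re (phase_integral c d) = \<dots>" .
  have "Im (phase_integral c d) = integral {- 1..1} (\<lambda>s. sin (c * s + d * legendre2 s))"
    unfolding phase_integral_def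
    using integral_linear[OF phase_integrable bounded_linear_Im, of c d] by (simp add: o_def)
  also have "\<dots> = integral {- 1..1} (\<lambda>s. cos (c * s) * sin (d * legendre2 s))"
    using odd[of cos] int[of cos sin] int[of sin cos] by (simp add: sin_add integral_add)
  finally show "Im (phase_integral c d) = \<dots>" .
qed

lemma phase_integral_uminus_left: "phase_integral (- c) d = phase_integral c d"
  by (rule complex_eqI) (simp_all add: Re_phase_integral Im_phase_integral)

lemma phase_integral_uminus_right: "phase_integral c (- d) = cnj (phase_integral c d)"
  by (rule complex_eqI) (simp_all add: Re_phase_integral Im_phase_integral)

lemma norm_phase_integral_le: "norm (phase_integral c d) \<le> 2"
  unfolding phase_integral_def
  using integral_norm_bound_integral[OF phase_integrable integrable_const_ivl[of 1], of c d] by simp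

text \<open>Integrates \<open>cos x * cos y \<ge> 1 - (x\<^sup>2 + y\<^sup>2) / 2\<close>, with mean values \<open>1 / 3\<close> of \<open>s\<^sup>2\<close> and
  \<open>1 / 5\<close> of \<open>(legendre2 s)\<^sup>2\<close>.\<close>
lemma Re_phase_integral_ge: "2 * (1 - c\<^sup>2 / 6 - d\<^sup>2 / 10) \<le> Re (phase_integral c d)"
proof -
  have "((\<lambda>s. 1 - ((c * s)\<^sup>2 + (d * legendre2 s)\<^sup>2) / 2) has_integral
      (\<lambda>s. s - c\<^sup>2 * s ^ 3 / 6 - d\<^sup>2 * (9 * s ^ 5 / 5 - 2 * s ^ 3 + s) / 8) 1
      - (\<lambda>s. s - c\<^sup>2 * s ^ 3 / 6 - d\<^sup>2 * (9 * s ^ 5 / 5 - 2 * s ^ 3 + s) / 8) (- 1)) {- 1..1}"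
    by (rule has_integral_antiderivative)
      (auto intro!: derivative_eq_intros simp: legendre2_def eval_nat_numeral field_simps)
  then have int: "((\<lambda>s. 1 - ((c * s)\<^sup>2 + (d * legendre2 s)\<^sup>2) / 2) has_integral
      2 * (1 - c\<^sup>2 / 6 - d\<^sup>2 / 10)) {- 1..1}"
    by (simp add: algebra_simps)
  show ?thesis
    unfolding Re_phase_integral
    by (rule has_integral_le[OF int integrable_integral])
      (auto intro!: integrable_continuous_interval continuous_intros cos_mult_cos_ge)
qed

text \<open>Integration by parts with the primitive \<open>(s ^ 3 - s) / 2\<close> of \<open>legendre2\<close>, which vanishes at both
  ends, gives an integrand of constant sign, and \<open>z * sin z \<le> z\<^sup>2\<close> gives the lower bound.\<close>
lemma integral_legendre2_cos:
  assumes "\<bar>c\<bar> \<le> 3"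
  shows "integral {- 1..1} (\<lambda>s. legendre2 s * cos (c * s)) \<in> {- (2 / 15) * c\<^sup>2 .. 0}"
proof -
  let ?g = "\<lambda>s. (s - s ^ 3) / 2 * (c * sin (c * s))"
  have "((\<lambda>s. legendre2 s * cos (c * s) + ?g s) has_integral
      (\<lambda>s. (s ^ 3 - s) / 2 * cos (c * s)) 1 - (\<lambda>s. (s ^ 3 - s) / 2 * cos (c * s)) (- 1)) {- 1..1}"
    by (rule has_integral_antiderivative)
      (auto intro!: derivative_eq_intros simp: legendre2_def eval_nat_numeral field_simps)
  then have "integral {- 1..1} (\<lambda>s. legendre2 s * cos (c * s) + ?g s) = 0"
    by (simp add: integral_unique)
  moreover have intg: "?g integrable_on {- 1..1}"
    by (auto intro!: integrable_continuous_interval continuous_intros)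
  moreover have "(\<lambda>s. legendre2 s * cos (c * s)) integrable_on {- 1..1}"
    by (auto intro!: integrable_continuous_interval continuous_intros)
  ultimately have eq: "integral {- 1..1} (\<lambda>s. legendre2 s * cos (c * s)) = - integral {- 1..1} ?g"
    by (simp add: integral_add)
  have g: "0 \<le> ?g s \<and> ?g s \<le> (1 - s\<^sup>2) / 2 * (c * s)\<^sup>2" if "s \<in> {- 1..1}" for s
  proof -
    have "\<bar>c * s\<bar> \<le> 3 * 1" unfolding abs_mult using assms that by (intro mult_mono) auto
    moreover have "3 < pi" using pi_approx(1) by simp
    ultimately have cs: "\<bar>c * s\<bar> < pi" by linarith
    have s1: "s\<^sup>2 \<le> 1" using that by (simp add: abs_square_le_1 abs_le_iff)
    have "0 \<le> c * s * sin (c * s)"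
    proof (cases "0 \<le> c * s")
      case True
      then show ?thesis using cs by (intro mult_nonneg_nonneg[OF True] sin_ge_zero) auto
    next
      case False
      then show ?thesis using cs sin_ge_zero[of "- (c * s)"] by (simp add: mult_nonpos_nonpos)
    qed
    moreover have "c * s * sin (c * s) \<le> \<bar>c * s\<bar> * \<bar>sin (c * s)\<bar>"
      by (metis abs_ge_self abs_mult)
    moreover have "\<bar>c * s\<bar> * \<bar>sin (c * s)\<bar> \<le> \<bar>c * s\<bar> * \<bar>c * s\<bar>"
      by (intro mult_left_mono abs_sin_x_le_abs_x) auto
    moreover have "?g s = (1 - s\<^sup>2) / 2 * (c * s * sin (c * s))"
      by (simp add: eval_nat_numeral algebra_simps)
    moreover have "\<bar>c * s\<bar> * \<bar>c * s\<bar> = (c * s)\<^sup>2" by (simp add: power2_eq_square)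
    ultimately have "0 \<le> c * s * sin (c * s)" "c * s * sin (c * s) \<le> (c * s)\<^sup>2"
      and eq: "?g s = (1 - s\<^sup>2) / 2 * (c * s * sin (c * s))" by linarith+
    then show ?thesis
      unfolding eq using s1 by (auto intro!: mult_left_mono mult_nonneg_nonneg[of "(1 - s\<^sup>2) / 2"])
  qed
  have "((\<lambda>s. (1 - s\<^sup>2) / 2 * (c * s)\<^sup>2) has_integral
      (\<lambda>s. c\<^sup>2 * (s ^ 3 / 6 - s ^ 5 / 10)) 1 - (\<lambda>s. c\<^sup>2 * (s ^ 3 / 6 - s ^ 5 / 10)) (- 1)) {- 1..1}"
    by (rule has_integral_antiderivative)
      (auto intro!: derivative_eq_intros simp: eval_nat_numeral field_simps)
  then have "((\<lambda>s. (1 - s\<^sup>2) / 2 * (c * s)\<^sup>2) has_integral (2 / 15) * c\<^sup>2) {- 1..1}"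
    by (simp add: algebra_simps)
  from has_integral_le[OF integrable_integral[OF intg] this] g
  have "integral {- 1..1} ?g \<le> (2 / 15) * c\<^sup>2" by blast
  moreover have "0 \<le> integral {- 1..1} ?g"
    by (rule integral_nonneg[OF intg]) (use g in blast)
  ultimately show ?thesis unfolding eq by simp
qed

text \<open>Replaces \<open>sin z\<close> by \<open>z = d * legendre2 s\<close> in the integrand of the imaginary part.  The cubic error of
  \<open>sin\<close> has the sign of \<open>z\<close>, so where \<open>cos (c * s)\<close> is nonnegative it enters the upper bound only where
  \<open>legendre2 s < 0\<close>, where \<open>- legendre2 s \<le> (1 - s\<^sup>2) / 2\<close>, and the lower bound only where
  \<open>legendre2 s \<ge> 0\<close>, where \<open>legendre2 s \<le> s\<^sup>2\<close>.  The distinction matters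
  because the contraction estimate needs a small upper bound.
  The cosine is negative only if \<open>c\<^sup>2 > 2\<close>; then \<open>d\<^sup>2 < 4 / 5\<close>, and \<open>d / 75\<close> absorbs the error.\<close>
lemma sin_legendre2_bounds:
  assumes d: "0 \<le> d" and cd: "c\<^sup>2 + d\<^sup>2 \<le> 14 / 5" and s: "s \<in> {- 1..1}"
  shows "cos (c * s) * sin (d * legendre2 s)
      \<le> d * (legendre2 s * cos (c * s)) + (d ^ 3 * (1 - s\<^sup>2) ^ 3 / 48 + d / 75)" (is "?L \<le> ?U")
    and "d * (legendre2 s * cos (c * s)) - d ^ 3 * s ^ 6 / 6
      \<le> cos (c * s) * sin (d * legendre2 s)"
proof -
  define z where "z = d * legendre2 s"
  define K where "K = cos (c * s)"
  have s2: "s\<^sup>2 \<le> 1" using s by (simp add: abs_square_le_1 abs_le_iff)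
  have K1: "K \<le> 1" by (simp add: K_def)
  have K_ge: "1 - c\<^sup>2 * s\<^sup>2 / 2 \<le> K" using cos_ge_quadratic[of "c * s"] by (simp add: K_def power_mult_distrib)
  have d2: "d\<^sup>2 \<le> 14 / 5" "c\<^sup>2 \<le> 14 / 5" using cd zero_le_power2[of c] zero_le_power2[of d] by linarith+
  have slack: "0 \<le> d ^ 3 * (1 - s\<^sup>2) ^ 3 / 48" "0 \<le> d / 75" "0 \<le> d ^ 3 * s ^ 6 / 6"
    using d s2 by auto
  have "K * sin z \<le> z * K + (d ^ 3 * (1 - s\<^sup>2) ^ 3 / 48 + d / 75) \<and> z * K - d ^ 3 * s ^ 6 / 6 \<le> K * sin z"
  proof (cases "0 \<le> legendre2 s")
    case P: True
    then have z: "0 \<le> z" using d by (simp add: z_def)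
    have sinz: "sin z \<le> z" "z - z ^ 3 / 6 \<le> sin z" using sin_x_le_x[OF z] sin_ge_cubic[OF z] by auto
    have "legendre2 s \<le> s\<^sup>2" using s2 by (simp add: legendre2_def)
    then have "z ^ 3 \<le> (d * s\<^sup>2) ^ 3" using d z by (auto simp: z_def intro!: power_mono mult_left_mono)
    then have z3: "z ^ 3 \<le> d ^ 3 * s ^ 6" by (simp add: power_mult_distrib flip: power_mult)
    show ?thesis
    proof (cases "0 \<le> K")
      case True
      have "(z - sin z) * K \<le> (z - sin z) * 1" using sinz K1 by (intro mult_left_mono) auto
      moreover have "K * sin z \<le> K * z" using True sinz by (intro mult_left_mono) auto
      moreover have "(z - sin z) * K = z * K - K * sin z" "K * z = z * K" by (simp_all add: algebra_simps)
      ultimately show ?thesis using sinz z3 slack by argo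
    next
      case False
      \<comment> \<open>The cosine exceeds \<open>1 - c\<^sup>2 / 2\<close>, and the side condition turns this into a bound by \<open>d\<close> alone.\<close>
      have "c\<^sup>2 * s\<^sup>2 \<le> c\<^sup>2 * 1" using s2 by (intro mult_left_mono) auto
      then have negK: "- K \<le> 2 / 5 - d\<^sup>2 / 2" using K_ge cd by simp
      have d2': "d\<^sup>2 \<le> 4 / 5" using negK False by simp
      have "s ^ 6 \<le> 1" using power_le_one[of "s\<^sup>2" 3] s2 by (simp flip: power_mult)
      then have "d ^ 3 * s ^ 6 \<le> d ^ 3 * 1" using d by (intro mult_left_mono) auto
      then have "z ^ 3 \<le> d ^ 3" using z3 by simp
      then have "(z - sin z) * (- K) \<le> d ^ 3 / 6 * (2 / 5 - d\<^sup>2 / 2)"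
        using sinz negK False d by (intro mult_mono) auto
      also have "\<dots> = d * (d\<^sup>2 * (4 / 5 - d\<^sup>2) / 12)" by (simp add: eval_nat_numeral algebra_simps)
      \<comment> \<open>The product of two numbers with sum \<open>4 / 5\<close> is at most \<open>(2 / 5)\<^sup>2\<close>.\<close>
      also have "d\<^sup>2 * (4 / 5 - d\<^sup>2) \<le> 4 / 25"
        using zero_le_power2[of "d\<^sup>2 - 2 / 5"] by (simp add: power2_eq_square algebra_simps)
      then have "d * (d\<^sup>2 * (4 / 5 - d\<^sup>2) / 12) \<le> d * (1 / 75)"
        using d by (intro mult_left_mono) auto
      finally have "(z - sin z) * (- K) \<le> d / 75" by simp
      moreover have "0 \<le> (z - sin z) * (- K)" using sinz False by (intro mult_nonneg_nonneg) auto
      moreover have "(z - sin z) * (- K) = K * sin z - z * K" by (simp add: algebra_simps)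
      ultimately show ?thesis using slack by linarith
    qed
  next
    case P: False
    have s3: "s\<^sup>2 < 1 / 3" using P by (simp add: legendre2_def)
    have "c\<^sup>2 * s\<^sup>2 \<le> 14 / 5 * (1 / 3)" using d2 s3 by (intro mult_mono) auto
    then have K0: "0 \<le> K" using K_ge by simp
    have z: "0 \<le> - z" using P d by (simp add: z_def mult_nonneg_nonpos)
    have sinz: "z \<le> sin z" "sin z \<le> z + (- z) ^ 3 / 6"
      using sin_x_le_x[OF z] sin_ge_cubic[OF z] by auto
    have "- legendre2 s \<le> (1 - s\<^sup>2) / 2"
      using zero_le_power2[of s] by (simp add: legendre2_def field_simps)
    then have "(- z) ^ 3 \<le> (d * ((1 - s\<^sup>2) / 2)) ^ 3"
      using d z mult_left_mono[of "- legendre2 s" "(1 - s\<^sup>2) / 2" d] by (intro power_mono) (auto simp: z_def)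
    then have z3: "(- z) ^ 3 \<le> d ^ 3 * (1 - s\<^sup>2) ^ 3 / 8" by (simp add: power_mult_distrib power_divide)
    have "(sin z - z) * K \<le> (sin z - z) * 1" using sinz K1 by (intro mult_left_mono) auto
    moreover have "K * z \<le> K * sin z" using K0 sinz by (intro mult_left_mono) auto
    moreover have "(sin z - z) * K = K * sin z - z * K" "K * z = z * K" by (simp_all add: algebra_simps)
    ultimately show ?thesis using sinz z3 slack by argo
  qed
  then show "?L \<le> ?U" and "d * (legendre2 s * cos (c * s)) - d ^ 3 * s ^ 6 / 6
      \<le> cos (c * s) * sin (d * legendre2 s)"
    by (simp_all add: z_def K_def mult.assoc)
qed

lemma Im_phase_integral_bounds:
  assumes d: "0 \<le> d" and cd: "c\<^sup>2 + d\<^sup>2 \<le> 14 / 5"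
  shows "Im (phase_integral c d) \<le> 2 * d * (d\<^sup>2 / 105 + 1 / 75)"
    and "- (2 * d * (c\<^sup>2 / 15 + d\<^sup>2 / 42)) \<le> Im (phase_integral c d)"
proof -
  let ?f = "\<lambda>s. legendre2 s * cos (c * s)"
  have int: "(?f has_integral integral {- 1..1} ?f) {- 1..1}"
    by (rule integrable_integral) (auto intro!: integrable_continuous_interval continuous_intros)
  have "c\<^sup>2 \<le> 14 / 5" using cd zero_le_power2[of d] by linarith
  then have "c\<^sup>2 \<le> 3\<^sup>2" by simp
  then have "\<bar>c\<bar> \<le> 3" using abs_le_square_iff[of c 3] by simp
  note G = integral_legendre2_cos[OF this]
  have intS: "((\<lambda>s. cos (c * s) * sin (d * legendre2 s)) has_integral Im (phase_integral c d)) {- 1..1}"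
    unfolding Im_phase_integral
    by (rule integrable_integral) (auto intro!: integrable_continuous_interval continuous_intros)
  have "((\<lambda>s. d ^ 3 * (1 - s\<^sup>2) ^ 3 / 48 + d / 75) has_integral
      (\<lambda>s. d ^ 3 * (s - s ^ 3 + 3 * s ^ 5 / 5 - s ^ 7 / 7) / 48 + d * s / 75) 1
      - (\<lambda>s. d ^ 3 * (s - s ^ 3 + 3 * s ^ 5 / 5 - s ^ 7 / 7) / 48 + d * s / 75) (- 1)) {- 1..1}"
    by (rule has_integral_antiderivative)
      (auto intro!: derivative_eq_intros simp: eval_nat_numeral field_simps)
  then have up: "((\<lambda>s. d ^ 3 * (1 - s\<^sup>2) ^ 3 / 48 + d / 75) has_integral 2 * d * (d\<^sup>2 / 105 + 1 / 75)) {- 1..1}"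
    by (simp add: eval_nat_numeral algebra_simps)
  have "Im (phase_integral c d) \<le> d * integral {- 1..1} ?f + 2 * d * (d\<^sup>2 / 105 + 1 / 75)"
    by (rule has_integral_le[OF intS has_integral_add[OF has_integral_mult_right[OF int] up]])
      (rule sin_legendre2_bounds(1)[OF d cd])
  moreover have "d * integral {- 1..1} ?f \<le> 0" using G d by (simp add: mult_nonneg_nonpos)
  ultimately show "Im (phase_integral c d) \<le> 2 * d * (d\<^sup>2 / 105 + 1 / 75)" by simp
  have "((\<lambda>s. d ^ 3 * s ^ 6 / 6) has_integral
      (\<lambda>s. d ^ 3 * s ^ 7 / 42) 1 - (\<lambda>s. d ^ 3 * s ^ 7 / 42) (- 1)) {- 1..1}"
    by (rule has_integral_antiderivative)
      (auto intro!: derivative_eq_intros simp: eval_nat_numeral field_simps)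
  then have lo: "((\<lambda>s. d ^ 3 * s ^ 6 / 6) has_integral 2 * d * (d\<^sup>2 / 42)) {- 1..1}"
    by (simp add: eval_nat_numeral algebra_simps)
  have "d * integral {- 1..1} ?f - 2 * d * (d\<^sup>2 / 42) \<le> Im (phase_integral c d)"
    by (rule has_integral_le[OF has_integral_diff[OF has_integral_mult_right[OF int] lo] intS])
      (rule sin_legendre2_bounds(2)[OF d cd])
  moreover have "d * (- (2 / 15) * c\<^sup>2) \<le> d * integral {- 1..1} ?f"
    using G d by (intro mult_left_mono) auto
  ultimately show "- (2 * d * (c\<^sup>2 / 15 + d\<^sup>2 / 42)) \<le> Im (phase_integral c d)"
    by (simp add: algebra_simps)
qed


lemma Arg_phase_integral_nonneg:
  assumes d: "0 \<le> d" and cd: "c\<^sup>2 + d\<^sup>2 \<le> 14 / 5"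
  defines "m \<equiv> 1 - c\<^sup>2 / 6 - d\<^sup>2 / 10"
  shows "Arg (phase_integral c d) \<le> d * ((d\<^sup>2 / 105 + 1 / 75) / m)"
    and "- (d * ((c\<^sup>2 / 15 + d\<^sup>2 / 42) / m)) \<le> Arg (phase_integral c d)"
proof -
  let ?J = "phase_integral c d"
  have m: "0 < m" using cd zero_le_power2[of c] zero_le_power2[of d] unfolding m_def by linarith
  have Re: "2 * m \<le> Re ?J" using Re_phase_integral_ge[of c d] by (simp add: m_def)
  have Arg: "Arg ?J = arctan (Im ?J / Re ?J)" using Re m by (intro arg_conv_arctan) auto
  have "Im ?J / Re ?J \<le> 2 * d * (d\<^sup>2 / 105 + 1 / 75) / (2 * m)"
    using Im_phase_integral_bounds(1)[OF d cd] Re m d by (intro frac_le) auto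
  then have "arctan (Im ?J / Re ?J) \<le> arctan (2 * d * (d\<^sup>2 / 105 + 1 / 75) / (2 * m))"
    by (simp only: arctan_le_iff)
  also have "\<dots> \<le> 2 * d * (d\<^sup>2 / 105 + 1 / 75) / (2 * m)"
    using d m by (intro arctan_le_self) auto
  finally show "Arg ?J \<le> d * ((d\<^sup>2 / 105 + 1 / 75) / m)" by (simp add: Arg)
  have "- Im ?J / Re ?J \<le> 2 * d * (c\<^sup>2 / 15 + d\<^sup>2 / 42) / (2 * m)"
    using Im_phase_integral_bounds(2)[OF d cd] Re m d by (intro frac_le) auto
  then have "arctan (- Im ?J / Re ?J) \<le> arctan (2 * d * (c\<^sup>2 / 15 + d\<^sup>2 / 42) / (2 * m))"
    by (simp only: arctan_le_iff)
  also have "\<dots> \<le> 2 * d * (c\<^sup>2 / 15 + d\<^sup>2 / 42) / (2 * m)"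
    using d m by (intro arctan_le_self) auto
  finally show "- (d * ((c\<^sup>2 / 15 + d\<^sup>2 / 42) / m)) \<le> Arg ?J" by (simp add: Arg arctan_minus)
qed

text \<open>The argument is \<open>arctan (Im / Re)\<close>, which is bounded by the quotient.  Writing it as a multiple of \<open>d\<close>
  extends the bounds to negative \<open>d\<close>, because changing the sign of \<open>d\<close> conjugates the integral.  The
  important point is the asymmetry: to leading order \<open>\<rho>\<close> equals
  \<open>c\<^sup>2 / 15 + d\<^sup>2 / 105\<close>, so its lower bound is much closer to zero than its upper bound.\<close>
lemma Arg_phase_integral:
  assumes cd: "c\<^sup>2 + d\<^sup>2 \<le> 14 / 5"
  defines "m \<equiv> 1 - c\<^sup>2 / 6 - d\<^sup>2 / 10"
  obtains \<rho> where "Arg (phase_integral c d) = - d * \<rho>"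
    and "- ((d\<^sup>2 / 105 + 1 / 75) / m) \<le> \<rho>" and "\<rho> \<le> (c\<^sup>2 / 15 + d\<^sup>2 / 42) / m"
proof -
  let ?J = "phase_integral c d"
  have m: "0 < m" using cd zero_le_power2[of c] zero_le_power2[of d] unfolding m_def by linarith
  define \<rho> where "\<rho> = (if d = 0 then 0 else - Arg ?J / d)"
  have pos: "Arg (phase_integral c \<bar>d\<bar>) = - \<bar>d\<bar> * \<rho>"
  proof (cases "0 \<le> d")
    case True
    then show ?thesis using Arg_phase_integral_nonneg[of 0 c] cd by (auto simp: \<rho>_def)
  next
    case False
    have "2 * m \<le> Re ?J" using Re_phase_integral_ge[of c d] by (simp add: m_def)
    with m have "0 < Re ?J" by linarith
    then have "Arg (cnj ?J) = - Arg ?J"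
      by (auto simp: Arg_cnj complex_is_Real_iff arg_conv_arctan)
    then show ?thesis using False phase_integral_uminus_right[of c d] by (simp add: \<rho>_def)
  qed
  show ?thesis
  proof
    show eq: "Arg ?J = - d * \<rho>"
      using pos by (cases "d = 0") (auto simp: \<rho>_def)
    have b: "- (\<bar>d\<bar> * ((c\<^sup>2 / 15 + d\<^sup>2 / 42) / m)) \<le> - \<bar>d\<bar> * \<rho>"
      "- \<bar>d\<bar> * \<rho> \<le> \<bar>d\<bar> * ((d\<^sup>2 / 105 + 1 / 75) / m)"
      using Arg_phase_integral_nonneg[of "\<bar>d\<bar>" c] cd pos by (simp_all add: m_def)
    show "- ((d\<^sup>2 / 105 + 1 / 75) / m) \<le> \<rho>"
    proof (cases "d = 0")
      case False
      from b(2) have "\<bar>d\<bar> * (- ((d\<^sup>2 / 105 + 1 / 75) / m)) \<le> \<bar>d\<bar> * \<rho>" by simp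
      then show ?thesis by (rule mult_left_le_imp_le) (use False in simp)
    qed (use m in \<open>simp add: \<rho>_def\<close>)
    show "\<rho> \<le> (c\<^sup>2 / 15 + d\<^sup>2 / 42) / m"
    proof (cases "d = 0")
      case False
      from b(1) have "\<bar>d\<bar> * \<rho> \<le> \<bar>d\<bar> * ((c\<^sup>2 / 15 + d\<^sup>2 / 42) / m)" by simp
      then show ?thesis by (rule mult_left_le_imp_le) (use False in simp)
    qed (use m in \<open>simp add: \<rho>_def\<close>)
  qed
qed

text \<open>A quadratic angle function on an interval with midpoint \<open>t\<close> and half-width \<open>h\<close>, with mean
  value \<open>m\<close>, reduces to the normalised phase integral.\<close>
lemma has_integral_quadratic_phase:
  fixes \<beta> :: "real \<Rightarrow> real"
  assumes h: "0 < h" and \<beta>: "\<And>s. \<beta> (h * s + t) = m + c * s + d * legendre2 s"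
  shows "((\<lambda>s. exp (\<i> * complex_of_real (\<beta> s))) has_integral (h * cis m * phase_integral c d)) {t - h..t + h}"
proof -
  have "((\<lambda>s. cis (c * s + d * legendre2 s)) has_integral phase_integral c d) (cbox (- 1) 1)"
    unfolding phase_integral_def by (simp add: integrable_integral phase_integrable)
  from has_integral_affinity'[OF this, of "1 / h" "- t / h"] h
  have "((\<lambda>s. cis (c * (s / h - t / h) + d * legendre2 (s / h - t / h))) has_integral (h * phase_integral c d))
      {h * (- 1 - - t / h)..h * (1 - - t / h)}"
    by (simp add: scaleR_conv_of_real)
  moreover have "h * (- 1 - - t / h) = t - h" "h * (1 - - t / h) = t + h"
    using h by (simp_all add: field_simps)
  ultimately have "((\<lambda>s. cis (c * (s / h - t / h) + d * legendre2 (s / h - t / h))) has_integral (h * phase_integral c d))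
      {t - h..t + h}" by simp
  from has_integral_mult_right[OF this, of "cis m"]
  have "((\<lambda>s. cis m * cis (c * (s / h - t / h) + d * legendre2 (s / h - t / h))) has_integral
      (h * cis m * phase_integral c d)) {t - h..t + h}"
    by (simp add: mult_ac)
  moreover have "cis m * cis (c * (s / h - t / h) + d * legendre2 (s / h - t / h)) = exp (\<i> * complex_of_real (\<beta> s))"
    for s
  proof -
    have "h * (s / h - t / h) + t = s" using h by (simp add: field_simps)
    then have "\<beta> s = m + (c * (s / h - t / h) + d * legendre2 (s / h - t / h))"
      using \<beta>[of "s / h - t / h"] by (simp add: add.assoc)
    then show ?thesis by (simp only: cis_mult cis_conv_exp[symmetric])
  qed
  ultimately show ?thesis by simp
qed

section \<open>Contraction of the chord angles\<close>

text \<open>The argument of a phase integral is the deviation of the chord direction from the mean tangent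
  angle.  The next lemmas bound it, relative to the Legendre coefficient of the phase, for the
  three curve segments that occur in one bisection: the whole segment, with coefficients \<open>y\<close> and
  \<open>x * (1 - \<kappa>)\<close>, and its two halves.\<close>
lemma angle_defect_bounds:
  assumes xy: "x\<^sup>2 + y\<^sup>2 \<le> 14 / 5" and k: "0 \<le> \<kappa>" "\<kappa> \<le> 1"
  obtains \<rho> where "Arg (phase_integral y (x * (1 - \<kappa>))) = - (x * (1 - \<kappa>)) * \<rho>" "- 57 / 1000 \<le> \<rho>" "\<rho> \<le> 36 / 100"
proof -
  define d where "d = x * (1 - \<kappa>)"
  have "(1 - \<kappa>)\<^sup>2 \<le> 1" using k by (simp add: power_le_one)
  then have "d\<^sup>2 \<le> x\<^sup>2" by (simp add: d_def power_mult_distrib mult_left_le)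
  then have yd: "y\<^sup>2 + d\<^sup>2 \<le> 14 / 5" using xy by simp
  define m where "m = 1 - y\<^sup>2 / 6 - d\<^sup>2 / 10"
  obtain \<rho> where \<rho>: "Arg (phase_integral y d) = - d * \<rho>"
    "- ((d\<^sup>2 / 105 + 1 / 75) / m) \<le> \<rho>" "\<rho> \<le> (y\<^sup>2 / 15 + d\<^sup>2 / 42) / m"
    using Arg_phase_integral[OF yd] unfolding m_def by metis
  have y0: "0 \<le> y\<^sup>2" and d0: "0 \<le> d\<^sup>2" by auto
  have m: "0 < m" unfolding m_def using yd y0 d0 by argo
  have "d\<^sup>2 / 105 + 1 / 75 \<le> 57 / 1000 * m" unfolding m_def using yd y0 d0 by argo
  then have "(d\<^sup>2 / 105 + 1 / 75) / m \<le> 57 / 1000" using m by (simp add: pos_divide_le_eq)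
  moreover have "y\<^sup>2 / 15 + d\<^sup>2 / 42 \<le> 36 / 100 * m" unfolding m_def using yd y0 d0 by argo
  then have "(y\<^sup>2 / 15 + d\<^sup>2 / 42) / m \<le> 36 / 100" using m by (simp add: pos_divide_le_eq)
  ultimately show ?thesis using that[of \<rho>] \<rho> unfolding d_def by linarith
qed

text \<open>Bounds the linear coefficient of the phase on a half, by the Cauchy-Schwarz inequality for \<open>(u, v)\<close>
  and \<open>(3, 2)\<close>.\<close>
lemma half_phase_slope_le:
  fixes u v :: real
  assumes "u\<^sup>2 + v\<^sup>2 \<le> 14 / 5"
  shows "((3 * u + 2 * v) / 4)\<^sup>2 \<le> 91 / 40"
proof -
  have "(3 * u + 2 * v)\<^sup>2 + (2 * u - 3 * v)\<^sup>2 = 13 * (u\<^sup>2 + v\<^sup>2)"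
    by (simp add: power2_eq_square algebra_simps)
  then have "(3 * u + 2 * v)\<^sup>2 \<le> 182 / 5"
    using assms zero_le_power2[of "2 * u - 3 * v"] by argo
  then show ?thesis by (simp add: power_divide)
qed

lemma half_angle_defect_bounds:
  assumes xy: "x\<^sup>2 + y\<^sup>2 \<le> 14 / 5" and k: "0 \<le> \<kappa>" "\<kappa> \<le> 1"
  obtains \<rho> where "Arg (phase_integral ((3 * (x * (1 - \<kappa>)) + 2 * y) / 4) (x * (1 - \<kappa>) / 4)) = - (x * (1 - \<kappa>) / 4) * \<rho>"
    "- 25 / 1000 \<le> \<rho>" "\<rho> \<le> 26 / 100"
proof -
  define u where "u = x * (1 - \<kappa>)"
  have "(1 - \<kappa>)\<^sup>2 \<le> 1" using k by (simp add: power_le_one)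
  then have u2: "u\<^sup>2 \<le> x\<^sup>2" by (simp add: u_def power_mult_distrib mult_left_le)
  define c d where "c = (3 * u + 2 * y) / 4" and "d = u / 4"
  have "u\<^sup>2 + y\<^sup>2 \<le> 14 / 5" using u2 xy by linarith
  then have c2: "c\<^sup>2 \<le> 91 / 40" unfolding c_def by (rule half_phase_slope_le)
  have d2: "d\<^sup>2 \<le> 7 / 40" proof -
    have "u\<^sup>2 \<le> 14 / 5" using u2 xy zero_le_power2[of y] by linarith
    then show ?thesis by (simp add: d_def power_divide)
  qed
  define m where "m = 1 - c\<^sup>2 / 6 - d\<^sup>2 / 10"
  have cd: "c\<^sup>2 + d\<^sup>2 \<le> 14 / 5" using c2 d2 by simp
  obtain \<rho> where \<rho>: "Arg (phase_integral c d) = - d * \<rho>"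
    "- ((d\<^sup>2 / 105 + 1 / 75) / m) \<le> \<rho>" "\<rho> \<le> (c\<^sup>2 / 15 + d\<^sup>2 / 42) / m"
    using Arg_phase_integral[OF cd] unfolding m_def by metis
  have m: "0 < m" unfolding m_def using c2 d2 by argo
  have "d\<^sup>2 / 105 + 1 / 75 \<le> 25 / 1000 * m" unfolding m_def using c2 d2 by argo
  then have "(d\<^sup>2 / 105 + 1 / 75) / m \<le> 25 / 1000" using m by (simp add: pos_divide_le_eq)
  moreover have "c\<^sup>2 / 15 + d\<^sup>2 / 42 \<le> 26 / 100 * m" unfolding m_def using c2 d2 by argo
  then have "(c\<^sup>2 / 15 + d\<^sup>2 / 42) / m \<le> 26 / 100" using m by (simp add: pos_divide_le_eq)
  ultimately show ?thesis using that[of \<rho>] \<rho> unfolding c_def d_def u_def by linarith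
qed

text \<open>The chord angles of the left half, as functions of half the sum \<open>x\<close> and half the difference \<open>y\<close> of
  the old ones.  Since both deviations \<open>e0\<close> and \<open>e1\<close> are multiples of \<open>x\<close>, the new angles are, up to
  sign, \<open>x * P + y / 2\<close> and \<open>x * Q + y / 2\<close>, where \<open>P = 1\<close> and \<open>Q = 1 / 2\<close> in the linearisation.
  All nonlinear effects are thus confined to two numbers, and the estimate holds as long as these do
  not exceed the linear values by too much: \<open>P\<close> grows by at most a quarter of the bound for the halves
  and by the small amount by which the bound for the whole segment may be negative, while a
  decrease of \<open>P\<close> or \<open>Q\<close> down to zero is harmless.\<close>
lemma bisected_angles_contract:
  fixes x y \<kappa> :: real
  assumes xy: "x\<^sup>2 + y\<^sup>2 \<le> 14 / 5" and k: "0 \<le> \<kappa>" "\<kappa> \<le> 1 / 5"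
  defines "e0 \<equiv> Arg (phase_integral y (x * (1 - \<kappa>)))"
    and "e1 \<equiv> Arg (phase_integral ((3 * (x * (1 - \<kappa>)) + 2 * y) / 4) (x * (1 - \<kappa>) / 4))"
  shows "(x + y / 2 + e0 - e1)\<^sup>2 + (- (x + y) / 2 + x * \<kappa> / 2 - e1)\<^sup>2 \<le> 99 / 100 * (2 * (x\<^sup>2 + y\<^sup>2))"
proof -
  have k1: "\<kappa> \<le> 1" using k by simp
  obtain \<rho>0 where e0: "e0 = - (x * (1 - \<kappa>)) * \<rho>0" and r0: "- 57 / 1000 \<le> \<rho>0" "\<rho>0 \<le> 36 / 100"
    using angle_defect_bounds[OF xy k(1) k1] unfolding e0_def by metis
  obtain \<rho>1 where e1: "e1 = - (x * (1 - \<kappa>) / 4) * \<rho>1" and r1: "- 25 / 1000 \<le> \<rho>1" "\<rho>1 \<le> 26 / 100"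
    using half_angle_defect_bounds[OF xy k(1) k1] unfolding e1_def by metis
  define r0 r1 where "r0 = (1 - \<kappa>) * \<rho>0" and "r1 = (1 - \<kappa>) * \<rho>1"
  have scale: "lo \<le> (1 - \<kappa>) * r \<and> (1 - \<kappa>) * r \<le> hi" if "lo \<le> r" "r \<le> hi" "lo \<le> 0" "0 \<le> hi" for lo r hi :: real
  proof -
    have "(1 - \<kappa>) * lo \<le> (1 - \<kappa>) * r" "(1 - \<kappa>) * r \<le> (1 - \<kappa>) * hi"
      using that k1 by (auto intro: mult_left_mono)
    moreover have "(1 - \<kappa>) * hi \<le> hi" using that k k1 by (intro mult_left_le_one_le) auto
    moreover have "(1 - \<kappa>) * (- lo) \<le> - lo" using that k k1 by (intro mult_left_le_one_le) auto
    ultimately show ?thesis by simp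
  qed
  have r0': "- 57 / 1000 \<le> r0" "r0 \<le> 36 / 100" and r1': "- 25 / 1000 \<le> r1" "r1 \<le> 26 / 100"
    unfolding r0_def r1_def using scale[OF r0] scale[OF r1] by simp_all
  define P Q where "P = 1 - r0 + r1 / 4" and "Q = 1 / 2 - \<kappa> / 2 - r1 / 4"
  have P: "0 \<le> P" "P \<le> 1122 / 1000" and Q: "0 \<le> Q" "Q \<le> 507 / 1000"
    using r0' r1' k by (simp_all add: P_def Q_def)
  have "P\<^sup>2 \<le> (1122 / 1000)\<^sup>2" "Q\<^sup>2 \<le> (507 / 1000)\<^sup>2" using P Q by (auto intro: power_mono)
  then have PQ: "P\<^sup>2 + Q\<^sup>2 \<le> 1516 / 1000" by (simp add: power2_eq_square)
  have "(x + y / 2 + e0 - e1)\<^sup>2 + (- (x + y) / 2 + x * \<kappa> / 2 - e1)\<^sup>2 = (x * P + y / 2)\<^sup>2 + (x * Q + y / 2)\<^sup>2"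
  proof -
    have "x + y / 2 + e0 - e1 = x * P + y / 2" "- (x + y) / 2 + x * \<kappa> / 2 - e1 = - (x * Q + y / 2)"
      by (simp_all add: e0 e1 P_def Q_def r0_def r1_def field_simps)
    then show ?thesis by (simp only: power2_minus)
  qed
  also have "\<dots> = x\<^sup>2 * (P\<^sup>2 + Q\<^sup>2) + x * y * (P + Q) + y\<^sup>2 / 2"
    by (simp add: power2_eq_square field_simps)
  also have "\<dots> \<le> x\<^sup>2 * (1516 / 1000) + \<bar>x * y\<bar> * (1629 / 1000) + y\<^sup>2 / 2"
    using PQ P Q by (intro add_mono order_trans[OF mult_right_mono[OF abs_ge_self] mult_left_mono] mult_left_mono) auto
  also have "\<dots> \<le> 99 / 100 * (2 * (x\<^sup>2 + y\<^sup>2))"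
  proof -
    \<comment> \<open>Square roots, rounded down, of the coefficients \<open>1.98 - 1.516\<close> of \<open>x\<^sup>2\<close> and \<open>1.98 - 0.5\<close> of \<open>y\<^sup>2\<close>; twice their product still exceeds \<open>1.629\<close>.\<close>
    have "0 \<le> (68 / 100 * \<bar>x\<bar> - 12 / 10 * \<bar>y\<bar>)\<^sup>2" by simp
    then have "1632 / 1000 * \<bar>x * y\<bar> \<le> 4624 / 10000 * x\<^sup>2 + 144 / 100 * y\<^sup>2"
      by (simp add: power2_diff power_mult_distrib abs_mult power_divide)
    then show ?thesis using zero_le_power2[of x] zero_le_power2[of y] abs_ge_zero[of "x * y"] by argo
  qed
  finally show ?thesis .
qed

lemma angle_poly_half: "angle_poly (a, b) (1 / 2) = f_tilde a b"
  by (simp add: angle_poly_def lagr0_def lagr_half_def lagr1_def)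

text \<open>The angle polynomial in Legendre form.  For chord angles \<open>x + y\<close> and \<open>x - y\<close> its mean over the
  whole interval is \<open>x * \<kappa>\<close>, which comes from the cubic part of \<^const>\<open>f_tilde\<close> alone: the part
  \<open>- (b0 + b1) / 4\<close> is the value at \<open>1 / 2\<close> that makes the mean vanish.\<close>
lemma angle_integrals_as_phase_integrals:
  fixes x y :: real
  defines "\<kappa> \<equiv> (12 * x\<^sup>2 + 80 * y\<^sup>2) / 1173" and "\<beta> \<equiv> angle_poly (x + y, x - y)"
  shows "f_tilde (x + y) (x - y) = - x / 2 + 3 / 2 * (x * \<kappa>)"
    and "angle_integral \<beta> 1 = 1 / 2 * cis (x * \<kappa>) * phase_integral y (x * (1 - \<kappa>))"
    and "angle_integral \<beta> (1 / 2) = 1 / 4 * cis (y / 2 + x * \<kappa>)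
      * phase_integral ((3 * (x * (1 - \<kappa>)) + 2 * y) / 4) (x * (1 - \<kappa>) / 4)"
    and "angle_integral \<beta> 1 - angle_integral \<beta> (1 / 2) = 1 / 4 * cis (- y / 2 + x * \<kappa>)
      * phase_integral ((3 * (x * (1 - \<kappa>)) - 2 * y) / 4) (x * (1 - \<kappa>) / 4)"
proof -
  show f: "f_tilde (x + y) (x - y) = - x / 2 + 3 / 2 * (x * \<kappa>)"
    by (simp add: f_tilde_def \<kappa>_def power2_eq_square field_simps)
  have \<beta>: "\<beta> s = (x + y) * lagr0 s + (- x / 2 + 3 / 2 * (x * \<kappa>)) * lagr_half s + (x - y) * lagr1 s" for s
    by (simp add: \<beta>_def angle_poly_def f)
  note defs = \<beta> lagr0_def lagr_half_def lagr1_def legendre2_def power2_eq_square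
  \<comment> \<open>On the whole interval and on the left half the linear coefficient has the opposite sign; the phase integral is even in it.\<close>
  have whole: "((\<lambda>s. exp (\<i> * complex_of_real (\<beta> s))) has_integral
      (1 / 2 :: real) * cis (x * \<kappa>) * phase_integral (- y) (x * (1 - \<kappa>))) {1 / 2 - 1 / 2..1 / 2 + 1 / 2}"
    by (rule has_integral_quadratic_phase) (simp_all add: defs field_simps)
  have left: "((\<lambda>s. exp (\<i> * complex_of_real (\<beta> s))) has_integral
      (1 / 4 :: real) * cis (y / 2 + x * \<kappa>) * phase_integral (- ((3 * (x * (1 - \<kappa>)) + 2 * y) / 4)) (x * (1 - \<kappa>) / 4))
      {1 / 4 - 1 / 4..1 / 4 + 1 / 4}"
    by (rule has_integral_quadratic_phase) (simp_all add: defs field_simps)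
  have right: "((\<lambda>s. exp (\<i> * complex_of_real (\<beta> s))) has_integral
      (1 / 4 :: real) * cis (- y / 2 + x * \<kappa>) * phase_integral ((3 * (x * (1 - \<kappa>)) - 2 * y) / 4) (x * (1 - \<kappa>) / 4))
      {3 / 4 - 1 / 4..3 / 4 + 1 / 4}"
    by (rule has_integral_quadratic_phase) (simp_all add: defs field_simps)
  show "angle_integral \<beta> 1 = 1 / 2 * cis (x * \<kappa>) * phase_integral y (x * (1 - \<kappa>))"
    using integral_unique[OF whole] by (simp add: angle_integral_def phase_integral_uminus_left)
  show I1: "angle_integral \<beta> (1 / 2) = 1 / 4 * cis (y / 2 + x * \<kappa>)
      * phase_integral ((3 * (x * (1 - \<kappa>)) + 2 * y) / 4) (x * (1 - \<kappa>) / 4)"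
    using integral_unique[OF left] by (simp add: angle_integral_def phase_integral_uminus_left)
  let ?E = "\<lambda>s. exp (\<i> * complex_of_real (\<beta> s))"
  have sum: "integral {0..1 / 2} ?E + integral {1 / 2..1} ?E = integral {0..1} ?E"
    by (rule Henstock_Kurzweil_Integration.integral_combine) (use has_integral_integrable[OF whole] in auto)
  have R: "integral {1 / 2..1} ?E = 1 / 4 * cis (- y / 2 + x * \<kappa>)
      * phase_integral ((3 * (x * (1 - \<kappa>)) - 2 * y) / 4) (x * (1 - \<kappa>) / 4)"
    using integral_unique[OF right] by simp
  show "angle_integral \<beta> 1 - angle_integral \<beta> (1 / 2) = 1 / 4 * cis (- y / 2 + x * \<kappa>)
      * phase_integral ((3 * (x * (1 - \<kappa>)) - 2 * y) / 4) (x * (1 - \<kappa>) / 4)"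
    unfolding angle_integral_def sum[symmetric] R[symmetric] by (rule add_diff_cancel_left')
qed

section \<open>Bisection by the clothoid average\<close>

lemma cis_principal_angle: "cis (principal_angle x) = cis x"
  by (simp add: principal_angle_def cis_Arg)

lemma principal_angle_eqI:
  assumes "cis x = cis y" "\<bar>y\<bar> < pi"
  shows "principal_angle x = y"
  using assms by (simp add: principal_angle_def Arg_cis abs_less_iff)

lemma cis_Arg_of_polar:
  assumes "z = of_real r * cis t" "0 < r"
  shows "cis (Arg z) = cis t"
proof -
  have "z \<noteq> 0" using assms by simp
  then have "cis (Arg z) = sgn z" by (rule cis_Arg)
  also have "\<dots> = cis t" using assms by (simp add: sgn_mult sgn_of_real)
  finally show ?thesis .
qed

lemma norm_cis_minus_1_le: "norm (cis t - 1) \<le> \<bar>t\<bar>"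
proof -
  have "(norm (cis t - 1))\<^sup>2 = (cos t - 1)\<^sup>2 + (sin t)\<^sup>2"
    by (simp add: cmod_power2)
  also have "\<dots> = 2 - 2 * cos t" using sin_cos_squared_add[of t] by (simp add: power2_diff)
  also have "\<dots> \<le> \<bar>t\<bar>\<^sup>2" using cos_ge_quadratic[of t] by simp
  finally show ?thesis by (rule power2_le_imp_le) simp
qed

text \<open>With \<open>pi \<le> 3.15\<close>; in terms of half the sum and half the difference of the angles this is the
  condition \<open>x\<^sup>2 + y\<^sup>2 \<le> 14 / 5\<close> of the preceding estimates.\<close>
lemma Bstar_sum_squares:
  assumes "(a, b) \<in> Bstar"
  shows "a\<^sup>2 + b\<^sup>2 \<le> 28 / 5"
proof -
  have n: "sqrt (a\<^sup>2 + b\<^sup>2) \<le> 3 * pi / 4" using assms by (simp add: Bstar_def norm_prod_def)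
  have "pi \<le> 315 / 100" using pi_approx(2) by simp
  with n have "sqrt (a\<^sup>2 + b\<^sup>2) \<le> 945 / 400" by simp
  then have "(sqrt (a\<^sup>2 + b\<^sup>2))\<^sup>2 \<le> (945 / 400)\<^sup>2" by (intro power_mono) auto
  then show ?thesis by (simp add: power2_eq_square)
qed

text \<open>One bisection.  The two new chords are \<open>z / I\<close> times the angle integrals \<open>I1\<close>, \<open>I2\<close> over the
  two halves, where \<open>z\<close> is the old chord and \<open>I = I1 + I2\<close>.  Lengths: \<open>I1\<close> and \<open>I2\<close> have norm at most
  \<open>1 / 2\<close>, and the real part estimate gives \<open>norm I \<ge> 8 / 15\<close>.  Directions: the arguments are known
  only modulo \<open>2 * pi\<close> and therefore compared through \<^const>\<open>cis\<close>; the resulting real numbers turn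
  out to be smaller than \<open>pi\<close> and hence are the chord angles.  The right half is the left half with
  the sign of \<open>y\<close>, half the difference of the angles, reversed.\<close>
lemma clothoid_average_refines:
  fixes h0 h1 :: hermite
  assumes d0: "chord h0 h1 \<noteq> 0" and B: "chord_angles h0 h1 \<in> Bstar"
  defines "h \<equiv> clothoid_average h0 h1"
  shows "clothoid_average_defined h0 h1"
    and "chord h0 h \<noteq> 0" "chord h h1 \<noteq> 0"
    and "norm (chord h0 h) \<le> 15 / 16 * norm (chord h0 h1)"
    and "norm (chord h h1) \<le> 15 / 16 * norm (chord h0 h1)"
    and "norm (chord_angles h0 h) \<le> 199 / 200 * norm (chord_angles h0 h1)"
    and "norm (chord_angles h h1) \<le> 199 / 200 * norm (chord_angles h0 h1)"
proof -
  obtain a b where ab: "chord_angles h0 h1 = (a, b)" by force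
  define x y \<kappa> where "x = (a + b) / 2" and "y = (a - b) / 2" and "\<kappa> = (12 * x\<^sup>2 + 80 * y\<^sup>2) / 1173"
  have a: "a = x + y" and b: "b = x - y" by (simp_all add: x_def y_def field_simps)
  have n_ab: "a\<^sup>2 + b\<^sup>2 = 2 * (x\<^sup>2 + y\<^sup>2)" by (simp add: a b power2_eq_square algebra_simps)
  have xy: "x\<^sup>2 + y\<^sup>2 \<le> 14 / 5" using Bstar_sum_squares[of a b] B ab n_ab by simp
  have k: "0 \<le> \<kappa>" "\<kappa> \<le> 1 / 5"
    using xy zero_le_power2[of x] zero_le_power2[of y] unfolding \<kappa>_def by (simp, argo)
  define \<beta> where "\<beta> = angle_poly (a, b)"
  define z where "z = chord h0 h1"
  define \<theta> where "\<theta> = Arg z"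
  define J0 J1 J2 where "J0 = phase_integral y (x * (1 - \<kappa>))"
    and "J1 = phase_integral ((3 * (x * (1 - \<kappa>)) + 2 * y) / 4) (x * (1 - \<kappa>) / 4)"
    and "J2 = phase_integral ((3 * (x * (1 - \<kappa>)) - 2 * y) / 4) (x * (1 - \<kappa>) / 4)"
  define e0 e1 e2 where "e0 = Arg J0" and "e1 = Arg J1" and "e2 = Arg J2"
  define I1 I2 where "I1 = angle_integral \<beta> (1 / 2)" and "I2 = angle_integral \<beta> 1 - angle_integral \<beta> (1 / 2)"
  define I where "I = angle_integral \<beta> 1"
  note as_phase = angle_integrals_as_phase_integrals[of x y, folded \<kappa>_def a b, folded \<beta>_def J0_def J1_def J2_def,
      folded I2_def, folded I_def I1_def]
  have u2: "(x * (1 - \<kappa>))\<^sup>2 \<le> x\<^sup>2"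
    using k by (simp add: power_mult_distrib mult_left_le power_le_one)
  have Re_pos: "8 / 15 * 2 \<le> Re J0" "0 < Re J1" "0 < Re J2"
  proof -
    have y2: "0 \<le> y\<^sup>2" by simp
    have "2 * (1 - y\<^sup>2 / 6 - (x * (1 - \<kappa>))\<^sup>2 / 10) \<le> Re J0"
      unfolding J0_def by (rule Re_phase_integral_ge)
    then show "8 / 15 * 2 \<le> Re J0" using u2 xy y2 zero_le_power2[of "x * (1 - \<kappa>)"] by argo
    have *: "0 < Re (phase_integral ((3 * (x * (1 - \<kappa>)) + 2 * v) / 4) (x * (1 - \<kappa>) / 4))" if v: "v\<^sup>2 = y\<^sup>2" for v
    proof -
      define u where "u = x * (1 - \<kappa>)"
      have uv: "u\<^sup>2 + v\<^sup>2 \<le> 14 / 5" using u2 xy v by (simp add: u_def)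
      have c2: "((3 * u + 2 * v) / 4)\<^sup>2 \<le> 91 / 40" using uv by (rule half_phase_slope_le)
      have "u\<^sup>2 \<le> 14 / 5" using uv zero_le_power2[of v] by linarith
      then have d2: "(u / 4)\<^sup>2 \<le> 7 / 40" by (simp add: power_divide)
      show ?thesis
        using Re_phase_integral_ge[of "(3 * u + 2 * v) / 4" "u / 4"] c2 d2 unfolding u_def by argo
    qed
    from *[of y] *[of "- y"] show "0 < Re J1" "0 < Re J2" by (simp_all add: J1_def J2_def)
  qed
  have J_nz: "J0 \<noteq> 0" "J1 \<noteq> 0" "J2 \<noteq> 0" using Re_pos by auto
  have polar: "J = of_real (norm J) * cis (Arg J)" for J
    using rcis_cmod_Arg[of J] by (simp add: rcis_def)
  have polar_mult: "of_real c * cis s * J = of_real (norm J * c) * cis (s + Arg J)" for c s J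
    using arg_cong[OF polar[of J], of "\<lambda>w. of_real c * cis s * w"]
    by (simp add: mult_ac flip: cis_mult)
  have I_polar: "I = of_real (norm J0 / 2) * cis (x * \<kappa> + e0)"
    using as_phase(2) polar_mult[of "1 / 2" "x * \<kappa>" J0] by (simp add: e0_def)
  have I1_polar: "I1 = of_real (norm J1 / 4) * cis (y / 2 + x * \<kappa> + e1)"
    using as_phase(3) polar_mult[of "1 / 4" "y / 2 + x * \<kappa>" J1] by (simp add: e1_def)
  have I2_polar: "I2 = of_real (norm J2 / 4) * cis (- y / 2 + x * \<kappa> + e2)"
    using as_phase(4) polar_mult[of "1 / 4" "- y / 2 + x * \<kappa>" J2] by (simp add: e2_def)
  have I_nz: "I \<noteq> 0" using J_nz by (simp add: I_polar)
  show "clothoid_average_defined h0 h1"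
    using d0 I_nz by (simp add: clothoid_average_defined_def ab I_def \<beta>_def)
  have chords: "chord h0 h = z / I * I1" "chord h h1 = z / I * I2"
    using I_nz by (simp_all add: h_def clothoid_average_def clothoid_point_def chord_def ab
        z_def I_def I1_def I2_def \<beta>_def Let_def field_simps)
  have h_angle: "snd h = \<theta> + (- x / 2 + 3 / 2 * (x * \<kappa>)) - Arg I"
    using as_phase(1) by (simp add: h_def clothoid_average_def clothoid_angle_def ab \<theta>_def z_def I_def \<beta>_def
        Let_def angle_poly_half)
  have norm_J: "norm J1 \<le> 2" "norm J2 \<le> 2" unfolding J1_def J2_def by (rule norm_phase_integral_le)+
  have norm_J0: "16 / 15 \<le> norm J0" using Re_pos(1) complex_Re_le_cmod[of J0] by linarith
  have z_nz: "z \<noteq> 0" using d0 by (simp add: z_def)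
  have z_polar: "z = of_real (norm z) * cis \<theta>" unfolding \<theta>_def by (rule polar)
  show "chord h0 h \<noteq> 0" "chord h h1 \<noteq> 0"
    using z_nz I_nz J_nz by (simp_all add: chords I1_polar I2_polar)
  have ratio: "norm z / (norm J0 / 2) * (norm J / 4) \<le> 15 / 16 * norm z" if "norm J \<le> 2" for J :: complex
  proof -
    have "norm J / (2 * norm J0) \<le> 2 / (2 * (16 / 15))"
      using that norm_J0 by (intro frac_le) auto
    then have "norm z * (norm J / (2 * norm J0)) \<le> norm z * (15 / 16)"
      by (intro mult_left_mono) auto
    moreover have "norm z / (norm J0 / 2) * (norm J / 4) = norm z * (norm J / (2 * norm J0))"
      using J_nz by (simp add: field_simps)
    ultimately show ?thesis by (simp only: mult.commute)
  qed
  show "norm (chord h0 h) \<le> 15 / 16 * norm (chord h0 h1)" "norm (chord h h1) \<le> 15 / 16 * norm (chord h0 h1)"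
    using ratio norm_J by (simp_all add: chords norm_mult norm_divide I_polar I1_polar I2_polar z_def)
  have chord_polar: "cis (Arg (z / I * I')) = cis (\<theta> + (t - (x * \<kappa> + e0)))"
    if "I' = of_real r * cis t" "0 < r" for I' r t
  proof (rule cis_Arg_of_polar)
    have "z / I * I' = of_real (norm z / (norm J0 / 2) * r) * (cis \<theta> * (cis t / cis (x * \<kappa> + e0)))"
      by (subst z_polar) (simp add: I_polar that(1))
    then show "z / I * I' = of_real (norm z / (norm J0 / 2) * r) * cis (\<theta> + (t - (x * \<kappa> + e0)))"
      by (simp only: cis_divide cis_mult)
    show "0 < norm z / (norm J0 / 2) * r" using z_nz J_nz that by simp
  qed
  have Arg_chords: "cis (Arg (chord h0 h)) = cis (\<theta> + (y / 2 + e1 - e0))"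
    "cis (Arg (chord h h1)) = cis (\<theta> + (- y / 2 + e2 - e0))"
    unfolding chords using chord_polar[OF I1_polar] chord_polar[OF I2_polar] J_nz by (simp_all add: algebra_simps)
  have cis_ends: "cis (snd h0 - \<theta>) = cis a" "cis (snd h1 - \<theta>) = cis b"
    using ab cis_principal_angle by (auto simp: chord_angles_def \<theta>_def z_def)
  have cis_I: "cis (Arg I) = cis (x * \<kappa> + e0)"
    by (rule cis_Arg_of_polar[OF I_polar]) (use J_nz in simp)
  have cis_h: "cis (snd h - \<theta>) = cis (- x / 2 + 3 / 2 * (x * \<kappa>) - (x * \<kappa> + e0))"
  proof -
    have "cis (snd h - \<theta>) = cis (- x / 2 + 3 / 2 * (x * \<kappa>)) / cis (Arg I)"
      by (simp add: h_angle cis_divide algebra_simps)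
    then show ?thesis unfolding cis_I by (simp only: cis_divide)
  qed
  \<comment> \<open>From an angle relative to the old chord to the angle relative to a new one.\<close>
  have rel: "cis (\<alpha> - Arg w) = cis (u - t)" if "cis (\<alpha> - \<theta>) = cis u" "cis (Arg w) = cis (\<theta> + t)" for \<alpha> w u t
  proof -
    have "cis (\<alpha> - Arg w) = cis \<alpha> / cis (\<theta> + t)" unfolding that(2)[symmetric] by (simp only: cis_divide)
    also have "\<dots> = cis (\<alpha> - \<theta>) / cis t" by (simp add: cis_divide algebra_simps)
    also have "\<dots> = cis (u - t)" unfolding that(1) by (simp only: cis_divide)
    finally show ?thesis .
  qed
  have norm_ab: "norm (chord_angles h0 h1) = sqrt (2 * (x\<^sup>2 + y\<^sup>2))"
    by (simp add: ab norm_prod_def n_ab)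
  have norm_lt_pi: "199 / 200 * norm (chord_angles h0 h1) < pi"
  proof -
    have "norm (chord_angles h0 h1) \<le> 3 * pi / 4" using B by (simp add: Bstar_def)
    then show ?thesis using pi_gt_zero by linarith
  qed
  have conclude: "norm (chord_angles g0 g1) \<le> 199 / 200 * norm (chord_angles h0 h1)"
    if u: "cis (snd g0 - Arg (chord g0 g1)) = cis u" and v: "cis (snd g1 - Arg (chord g0 g1)) = cis v"
      and uv: "u\<^sup>2 + v\<^sup>2 \<le> 99 / 100 * (2 * (x\<^sup>2 + y\<^sup>2))" for g0 g1 u v
  proof -
    have "u\<^sup>2 + v\<^sup>2 \<le> (199 / 200)\<^sup>2 * (2 * (x\<^sup>2 + y\<^sup>2))"
      using uv by (rule order_trans) (intro mult_right_mono, auto simp: power2_eq_square)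
    then have "sqrt (u\<^sup>2 + v\<^sup>2) \<le> sqrt ((199 / 200)\<^sup>2 * (2 * (x\<^sup>2 + y\<^sup>2)))"
      by (rule real_sqrt_le_mono)
    also have "\<dots> = 199 / 200 * norm (chord_angles h0 h1)"
      unfolding norm_ab real_sqrt_mult[of "(199 / 200)\<^sup>2"] real_sqrt_abs by simp
    finally have le: "sqrt (u\<^sup>2 + v\<^sup>2) \<le> 199 / 200 * norm (chord_angles h0 h1)" .
    have "\<bar>u\<bar> \<le> sqrt (u\<^sup>2 + v\<^sup>2)" "\<bar>v\<bar> \<le> sqrt (u\<^sup>2 + v\<^sup>2)" by (auto intro: real_le_rsqrt)
    then have "\<bar>u\<bar> < pi" "\<bar>v\<bar> < pi" using le norm_lt_pi by linarith+
    then have "chord_angles g0 g1 = (u, v)"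
      using principal_angle_eqI[OF u] principal_angle_eqI[OF v] by (simp add: chord_angles_def)
    then show ?thesis using le by (simp add: norm_prod_def)
  qed
  show "norm (chord_angles h0 h) \<le> 199 / 200 * norm (chord_angles h0 h1)"
  proof (rule conclude)
    show "cis (snd h0 - Arg (chord h0 h)) = cis (x + y / 2 + e0 - e1)"
      using rel[OF cis_ends(1) Arg_chords(1)] by (simp add: a algebra_simps)
    show "cis (snd h - Arg (chord h0 h)) = cis (- (x + y) / 2 + x * \<kappa> / 2 - e1)"
    proof -
      have "- x / 2 + 3 / 2 * (x * \<kappa>) - (x * \<kappa> + e0) - (y / 2 + e1 - e0)
          = - (x + y) / 2 + x * \<kappa> / 2 - e1" by (simp add: field_simps)
      then show ?thesis using rel[OF cis_h Arg_chords(1)] by metis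
    qed
    show "(x + y / 2 + e0 - e1)\<^sup>2 + (- (x + y) / 2 + x * \<kappa> / 2 - e1)\<^sup>2 \<le> 99 / 100 * (2 * (x\<^sup>2 + y\<^sup>2))"
      using bisected_angles_contract[OF xy k] by (simp add: e0_def e1_def J0_def J1_def)
  qed
  show "norm (chord_angles h h1) \<le> 199 / 200 * norm (chord_angles h0 h1)"
  proof (rule conclude)
    show "cis (snd h - Arg (chord h h1)) = cis (- (x + - y) / 2 + x * \<kappa> / 2 - e2)"
    proof -
      have "- x / 2 + 3 / 2 * (x * \<kappa>) - (x * \<kappa> + e0) - (- y / 2 + e2 - e0)
          = - (x + - y) / 2 + x * \<kappa> / 2 - e2" by (simp add: field_simps)
      then show ?thesis using rel[OF cis_h Arg_chords(2)] by metis
    qed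
    show "cis (snd h1 - Arg (chord h h1)) = cis (x + - y / 2 + e0 - e2)"
      using rel[OF cis_ends(2) Arg_chords(2)] by (simp add: b algebra_simps)
    show "(- (x + - y) / 2 + x * \<kappa> / 2 - e2)\<^sup>2 + (x + - y / 2 + e0 - e2)\<^sup>2 \<le> 99 / 100 * (2 * (x\<^sup>2 + y\<^sup>2))"
      using bisected_angles_contract[of x "- y", OF _ k] xy phase_integral_uminus_left[of y]
      by (simp add: e0_def e2_def J0_def J2_def add.commute)
  qed
qed

section \<open>Convergence of the subdivision scheme\<close>

lemma periodic_mod:
  fixes f :: "int \<Rightarrow> 'a"
  assumes "\<And>j. f (j + int k) = f j"
  shows "f j = f (j mod int k)"
proof -
  have "f (i + n * int k) = f i" for i n
  proof (induction n rule: int_induct[where k = 0])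
    case (step1 n)
    then show ?case using assms[of "i + n * int k"] by (simp add: algebra_simps)
  next
    case (step2 n)
    then show ?case using assms[of "i + (n - 1) * int k"] by (simp add: algebra_simps)
  qed simp
  from this[of "j mod int k" "j div int k"] show ?thesis by simp
qed

text \<open>By periodicity the chord lengths take only finitely many values.\<close>
lemma periodic_chord_bounded:
  assumes "periodic_couples H"
  obtains D where "\<And>j. norm (chord (H j) (H (j + 1))) \<le> D"
proof -
  obtain k :: nat where k: "k \<ge> 2" "\<And>j. fst (H (j + int k)) = fst (H j)"
    using assms by (auto simp: periodic_couples_def hermite_eq_def)
  let ?c = "\<lambda>j. norm (chord (H j) (H (j + 1)))"
  have "?c (j + int k) = ?c j" for j
    using k(2)[of j] k(2)[of "j + 1"] by (simp add: chord_def algebra_simps)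
  then have mod: "?c j = ?c (j mod int k)" for j by (rule periodic_mod)
  have "?c j \<le> Max (?c ` {0..<int k})" for j
    unfolding mod[of j] using k(1) by (intro Max_ge) auto
  then show ?thesis using that by blast
qed

lemma S1_even: "S1 H (2 * j) = H j"
  by (simp add: S1_def)

lemma S1_odd: "S1 H (2 * j + 1) = clothoid_average (H j) (H (j + 1))"
  by (simp add: S1_def)

theorem theorem6p1:
  fixes H0 :: "int \<Rightarrow> hermite" and H :: "nat \<Rightarrow> int \<Rightarrow> hermite"
  defines "H \<equiv> (\<lambda>l. (S1 ^^ l) H0)"
  assumes "periodic_couples H0"
    and "\<And>j. chord (H0 j) (H0 (j + 1)) \<noteq> 0"
    and "\<And>j. chord_angles (H0 j) (H0 (j + 1)) \<in> Bstar"
  shows "(\<forall>l j. clothoid_average_defined (H l j) (H l (j + 1))) \<and>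
    (\<exists>p. polygons_converge_to (\<lambda>l j. fst (H l j)) p \<and> G1_curve p) \<and>
    (\<lambda>l. SUP j. \<bar>principal_angle (snd (H l j) - Arg (chord (H l j) (H l (j + 1))))\<bar>)
      \<longlonglongrightarrow> 0"
proof -
  define R where "R = 3 * pi / 4"
  define q r :: real where "q = 199 / 200" and "r = 15 / 16"
  have R: "0 \<le> R" by (simp add: R_def)
  have q: "0 \<le> q" "q < 1" and r: "0 \<le> r" "r < 1" by (simp_all add: q_def r_def)
  obtain D where D: "\<And>j. norm (chord (H0 j) (H0 (j + 1))) \<le> D"
    using periodic_chord_bounded[OF assms(2)] by blast
  have Bstar_if: "v \<in> Bstar" if "norm v \<le> R * q ^ l" for v l
  proof -
    have "R * q ^ l \<le> R * 1" using R q by (intro mult_left_mono power_le_one) auto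
    with that have "norm v \<le> R" by linarith
    then show ?thesis by (simp add: Bstar_def R_def)
  qed
  have H_Suc: "H (Suc l) = S1 (H l)" for l by (simp add: H_def)
  \<comment> \<open>Contraction of the angles keeps them in the disk, so that the bisection estimate applies again at the next level.\<close>
  have inv: "chord (H l j) (H l (j + 1)) \<noteq> 0 \<and>
      norm (chord_angles (H l j) (H l (j + 1))) \<le> R * q ^ l \<and>
      norm (chord (H l j) (H l (j + 1))) \<le> D * r ^ l" for l j
  proof (induction l arbitrary: j)
    case 0
    then show ?case using assms(3,4)[of j] D[of j] by (simp add: H_def Bstar_def R_def)
  next
    case (Suc l)
    define i where "i = j div 2"
    note IH = Suc[of i]
    have B: "chord_angles (H l i) (H l (i + 1)) \<in> Bstar" using IH Bstar_if by blast
    note refines = clothoid_average_refines[OF conjunct1[OF IH] B, folded q_def r_def]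
    have "q * norm (chord_angles (H l i) (H l (i + 1))) \<le> q * (R * q ^ l)"
      "r * norm (chord (H l i) (H l (i + 1))) \<le> r * (D * r ^ l)"
      using IH q r by (auto intro: mult_left_mono)
    then have bounds: "q * norm (chord_angles (H l i) (H l (i + 1))) \<le> R * q ^ Suc l"
      "r * norm (chord (H l i) (H l (i + 1))) \<le> D * r ^ Suc l"
      by (simp_all add: mult_ac)
    show ?case
    proof (cases "even j")
      case True
      then have "j = 2 * i" by (simp add: i_def)
      then have "H (Suc l) j = H l i" "H (Suc l) (j + 1) = clothoid_average (H l i) (H l (i + 1))"
        by (simp_all add: H_Suc S1_even S1_odd)
      then show ?thesis using refines(2,4,6) bounds by (auto intro: order_trans)
    next
      case False
      then have j: "j = 2 * i + 1" by (simp add: i_def)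
      have "H (Suc l) (j + 1) = H l (i + 1)" using S1_even[of "H l" "i + 1"] by (simp add: j H_Suc algebra_simps)
      moreover have "H (Suc l) j = clothoid_average (H l i) (H l (i + 1))" by (simp add: j H_Suc S1_odd)
      ultimately show ?thesis using refines(3,5,7) bounds by (auto intro: order_trans)
    qed
  qed
  have Bstar: "chord_angles (H l j) (H l (j + 1)) \<in> Bstar" for l j
    using inv Bstar_if by blast
  have angles: "\<bar>fst (chord_angles (H l j) (H l (j + 1)))\<bar> \<le> R * q ^ l"
    "\<bar>snd (chord_angles (H l j) (H l (j + 1)))\<bar> \<le> R * q ^ l" for l j
    using inv[of l j] norm_fst_le[of "fst (chord_angles (H l j) (H l (j + 1)))" "snd (chord_angles (H l j) (H l (j + 1)))"]
      norm_snd_le[of "snd (chord_angles (H l j) (H l (j + 1)))" "fst (chord_angles (H l j) (H l (j + 1)))"] by auto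
  \<comment> \<open>Chord angles measure the distance of the edge directions to the tangents at both ends.\<close>
  have tangent: "norm (sgn z - cis \<alpha>) \<le> \<bar>principal_angle (\<alpha> - Arg z)\<bar>" if "z \<noteq> 0" for z \<alpha>
  proof -
    have "cis \<alpha> - sgn z = cis (Arg z) * (cis (principal_angle (\<alpha> - Arg z)) - 1)"
      by (simp add: cis_principal_angle cis_mult right_diff_distrib cis_Arg[OF that, symmetric])
    then have "norm (cis \<alpha> - sgn z) = norm (cis (principal_angle (\<alpha> - Arg z)) - 1)"
      by (simp add: norm_mult)
    then show ?thesis using norm_cis_minus_1_le by (simp add: norm_minus_commute)
  qed
  interpret tangential_refinement "\<lambda>l j. fst (H l j)" "\<lambda>l j. cis (snd (H l j))" R q D r
  proof
    fix l j
    let ?z = "fst (H l (j + 1)) - fst (H l j)"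
    show "fst (H (Suc l) (2 * j)) = fst (H l j)" "cis (snd (H (Suc l) (2 * j))) = cis (snd (H l j))"
      by (simp_all add: H_Suc S1_even)
    show nz: "?z \<noteq> 0" and "norm ?z \<le> D * r ^ l" using inv[of l j] by (simp_all add: chord_def)
    show "norm (sgn ?z - cis (snd (H l j))) \<le> R * q ^ l"
      "norm (sgn ?z - cis (snd (H l (j + 1)))) \<le> R * q ^ l"
      using order_trans[OF tangent[OF nz]] angles[of l j] by (simp_all add: chord_angles_def chord_def)
  qed (use q r in auto)
  have "(\<lambda>l. SUP j. \<bar>principal_angle (snd (H l j) - Arg (chord (H l j) (H l (j + 1))))\<bar>) \<longlonglongrightarrow> 0"
  proof (rule tendsto_sandwich[OF always_eventually always_eventually])
    have le: "\<bar>principal_angle (snd (H l j) - Arg (chord (H l j) (H l (j + 1))))\<bar> \<le> R * q ^ l" for l j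
      using angles(1)[of l j] by (simp add: chord_angles_def)
    show "\<forall>l. (SUP j. \<bar>principal_angle (snd (H l j) - Arg (chord (H l j) (H l (j + 1))))\<bar>) \<le> R * q ^ l"
      by (intro allI cSUP_least) (use le in auto)
    show "\<forall>l. 0 \<le> (SUP j. \<bar>principal_angle (snd (H l j) - Arg (chord (H l j) (H l (j + 1))))\<bar>)"
      by (intro allI cSUP_upper2[where x = 0] bdd_aboveI2) (use le in auto)
    show "(\<lambda>l. R * q ^ l) \<longlonglongrightarrow> 0"
      using LIMSEQ_realpow_zero[OF q] by (rule tendsto_mult_right_zero)
  qed auto
  moreover have "clothoid_average_defined (H l j) (H l (j + 1))" for l j
    using clothoid_average_refines(1)[OF conjunct1[OF inv] Bstar] .
  ultimately show ?thesis using converges_to_G1_curve by blast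
qed

end
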